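(* Let $M$ be a connected regular matroid. Then $M$ is a circuit-difference matroid if and only if $M$ has no pair of skew circuits.
   Context: All matroids are finite. A matroid $M$ is circuit-difference if the symmetric difference $C_1\triangle C_2$ is a circuit of $M$ whenever $C_1$ and $C_2$ are distinct circuits of $M$ with $C_1\cap C_2\neq\emptyset$. Subsets $X$ and $Y$ of $E(M)$ are skew if $r(X\cup Y)=r(X)+r(Y)$, where $r$ is the rank function of $M$. A pair of skew circuits consists of two distinct circuits that are skew. *)

theory Defs
  imports "Jordan_Normal_Form.Determinant"
begin

locale matroid =
  fixes E :: "'a set" and indep :: "'a set \<Rightarrow> bool"
  assumes finite_ground: "finite E"
    and indep_subset_ground: "indep X \<Longrightarrow> X \<subseteq> E"
    and indep_empty: "indep {}"
    and indep_mono: "indep X \<Longrightarrow> Y \<subseteq> X \<Longrightarrow> indep Y"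
    and indep_augment:
      "indep X \<Longrightarrow> indep Y \<Longrightarrow> card X < card Y \<Longrightarrow> \<exists>y \<in> Y - X. indep (insert y X)"
begin

definition circuit :: "'a set \<Rightarrow> bool" where
  "circuit C \<longleftrightarrow> C \<subseteq> E \<and> \<not> indep C \<and> (\<forall>D. D \<subset> C \<longrightarrow> indep D)"

definition rank :: "'a set \<Rightarrow> nat" where
  "rank X = Max (card ` {Y. Y \<subseteq> X \<and> indep Y})"

definition connected_matroid :: bool where
  "connected_matroid \<longleftrightarrow>
     (\<forall>e \<in> E. \<forall>f \<in> E. e \<noteq> f \<longrightarrow> (\<exists>C. circuit C \<and> e \<in> C \<and> f \<in> C))"

definition circuit_difference :: bool where
  "circuit_difference \<longleftrightarrow>
     (\<forall>C D. circuit C \<and> circuit D \<and> C \<noteq> D \<and> C \<inter> D \<noteq> {} \<longrightarrow> circuit (sym_diff C D))"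

definition skew :: "'a set \<Rightarrow> 'a set \<Rightarrow> bool" where
  "skew X Y \<longleftrightarrow> X \<subseteq> E \<and> Y \<subseteq> E \<and> rank (X \<union> Y) = rank X + rank Y"

definition skew_circuits :: "'a set \<Rightarrow> 'a set \<Rightarrow> bool" where
  "skew_circuits C D \<longleftrightarrow> circuit C \<and> circuit D \<and> C \<noteq> D \<and> skew C D"

end

text \<open>
  A matrix with \<open>m\<close> rows whose columns are labelled by the elements of \<open>E\<close> is a function
  \<open>A\<close>, with entry \<open>A i e\<close> in row \<open>i < m\<close> and column \<open>e \<in> E\<close>. A \<open>k \<times> k\<close> submatrix is selected by
  injections \<open>r\<close>, \<open>c\<close> listing its row and column labels; the order only affects the sign of the determinant.
\<close>

definition totally_unimodular :: "nat \<Rightarrow> 'a set \<Rightarrow> (nat \<Rightarrow> 'a \<Rightarrow> real) \<Rightarrow> bool" where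
  "totally_unimodular m E A \<longleftrightarrow>
     (\<forall>k r c. inj_on r {..<k} \<and> r ` {..<k} \<subseteq> {..<m} \<and> inj_on c {..<k} \<and> c ` {..<k} \<subseteq> E \<longrightarrow>
        det (mat k k (\<lambda>(i, j). A (r i) (c j))) \<in> {-1, 0, 1})"

text \<open>
  Linear independence of the columns labelled by \<open>X\<close> is that of a family, not of the set of its
  values: two equal columns with distinct labels (parallel elements) are dependent.
\<close>

definition independent_columns :: "nat \<Rightarrow> (nat \<Rightarrow> 'a \<Rightarrow> real) \<Rightarrow> 'a set \<Rightarrow> bool" where
  "independent_columns m A X \<longleftrightarrow>
     (\<forall>a. (\<forall>i<m. (\<Sum>e\<in>X. a e * A i e) = 0) \<longrightarrow> (\<forall>e\<in>X. a e = 0))"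

context matroid
begin

definition represented_by :: "nat \<Rightarrow> (nat \<Rightarrow> 'a \<Rightarrow> real) \<Rightarrow> bool" where
  "represented_by m A \<longleftrightarrow> (\<forall>X \<subseteq> E. indep X \<longleftrightarrow> independent_columns m A X)"

definition regular :: bool where
  "regular \<longleftrightarrow> (\<exists>m A. totally_unimodular m E A \<and> represented_by m A)"

end

end

(*
  Write X + Y for the symmetric difference. In one direction, if C and D are skew and a
  circuit X meets both, then X and X + C + D are circuits that meet outside C \<union> D, while their sum
  C + D is not a circuit.

  Conversely, let C, D be meeting circuits with C + D not a circuit and |C \<union> D| minimal. Put
  K = C \<inter> D and G = C + D. Minimality forces every binary cycle properly inside G, and every cycle
  between K and C \<union> D, to be a circuit, and G to be a disjoint union of two circuits Z and W. By
  regularity each circuit supports exactly two null vectors with entries 1 and -1. Let n be the number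
  of null vectors with entries 1 and -1 supported on all of G, and s the number of cycles inside G.
  A pair (t, t') of such vectors amounts to the pair ((t + t')/2, (t - t')/2) of signed cycles that
  partition G, so n^2 = 2 n + 4 (s - 2). Similarly a pair (x, y) of signed cycles through K that
  partition G, with x = y on K, amounts to the pair (x + y, x - y), so n divides s. Hence n divides 8,
  and s = 4: the only circuits inside Z \<union> W are Z and W, which are therefore skew.
*)
theory Submission
  imports Defs
begin

section \<open>Null spaces and their elementary vectors\<close>

definition supp :: "('a \<Rightarrow> real) \<Rightarrow> 'a set" where
  "supp v = {e. v e \<noteq> 0}"

definition dependent :: "('a \<Rightarrow> real) set \<Rightarrow> 'a set \<Rightarrow> bool" where
  "dependent N X \<longleftrightarrow> (\<exists>v\<in>N. supp v \<noteq> {} \<and> supp v \<subseteq> X)"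

definition min_dependent :: "('a \<Rightarrow> real) set \<Rightarrow> 'a set \<Rightarrow> bool" where
  "min_dependent N C \<longleftrightarrow> dependent N C \<and> (\<forall>D. D \<subset> C \<longrightarrow> \<not> dependent N D)"

text \<open>Fixing the support exactly lets the later counts be sorted by support.\<close>

definition signings :: "('a \<Rightarrow> real) set \<Rightarrow> 'a set \<Rightarrow> ('a \<Rightarrow> real) set" where
  "signings N X = {v \<in> N. supp v = X \<and> (\<forall>e\<in>X. v e \<in> {-1, 1})}"

lemma notin_supp: "e \<notin> supp v \<longleftrightarrow> v e = 0"
  by (simp add: supp_def)

text \<open>A linear subspace standing for the dependencies of the columns of a matrix. Its minimal
  nonempty supports are the circuits, so the combinatorics can proceed without a matrix.\<close>

locale null_space =
  fixes E :: "'a set" and N :: "('a \<Rightarrow> real) set"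
  assumes finite_ground: "finite E"
    and supp_subset: "v \<in> N \<Longrightarrow> supp v \<subseteq> E"
    and nonempty: "N \<noteq> {}"
    and lincomb: "u \<in> N \<Longrightarrow> v \<in> N \<Longrightarrow> (\<lambda>e. a * u e + b * v e) \<in> N"
begin

abbreviation circ :: "'a set \<Rightarrow> bool" where
  "circ \<equiv> min_dependent N"

lemma zero: "(\<lambda>e. 0) \<in> N"
  using nonempty lincomb[where a = 0 and b = 0] by fastforce

lemma scale: "v \<in> N \<Longrightarrow> (\<lambda>e. a * v e) \<in> N"
  using lincomb[of v v a 0] by simp

lemma add: "u \<in> N \<Longrightarrow> v \<in> N \<Longrightarrow> (\<lambda>e. u e + v e) \<in> N"
  using lincomb[of u v 1 1] by simp

lemma diff: "u \<in> N \<Longrightarrow> v \<in> N \<Longrightarrow> (\<lambda>e. u e - v e) \<in> N"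
  using lincomb[of u v 1 "-1"] by simp

lemma half_add: "u \<in> N \<Longrightarrow> v \<in> N \<Longrightarrow> (\<lambda>e. (u e + v e) / 2) \<in> N"
  using lincomb[of u v "1/2" "1/2"] by (simp add: add_divide_distrib)

lemma half_diff: "u \<in> N \<Longrightarrow> v \<in> N \<Longrightarrow> (\<lambda>e. (u e - v e) / 2) \<in> N"
  using lincomb[of u v "1/2" "-1/2"] by (simp add: diff_divide_distrib)

lemma circ_minimal:
  assumes "circ C" "v \<in> N" "supp v \<subseteq> C" "supp v \<noteq> {}"
  shows "supp v = C"
  using assms unfolding min_dependent_def dependent_def by blast

lemma circ_vector:
  assumes "circ C"
  obtains v where "v \<in> N" "supp v = C" "C \<noteq> {}"
proof -
  obtain v where v: "v \<in> N" "supp v \<subseteq> C" "supp v \<noteq> {}"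
    using assms unfolding min_dependent_def dependent_def by blast
  then have "supp v = C"
    using circ_minimal assms by blast
  then show ?thesis
    using that v by blast
qed

lemma circ_nonempty: "circ C \<Longrightarrow> C \<noteq> {}"
  using circ_vector by blast

lemma circ_subset_ground: "circ C \<Longrightarrow> C \<subseteq> E"
  using circ_vector supp_subset by blast

lemma circ_antichain: "circ C \<Longrightarrow> circ D \<Longrightarrow> C \<subseteq> D \<Longrightarrow> C = D"
  unfolding min_dependent_def by blast

text \<open>The difference vanishes at \<open>e\<close>, so its support is a proper subset of the
  circuit and hence empty: the null vectors supported in a circuit form a line.\<close>

lemma circ_vector_unique:
  assumes "circ C" "e \<in> C" "u \<in> N" "v \<in> N" "supp u \<subseteq> C" "supp v \<subseteq> C" "u e = v e"
  shows "u = v"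
proof -
  let ?w = "\<lambda>f. u f - v f"
  have "supp ?w \<subseteq> supp u \<union> supp v" "e \<notin> supp ?w"
    using assms(7) by (auto simp: supp_def)
  then have "supp ?w = {}"
    using circ_minimal[OF assms(1) diff[OF assms(3,4)]] assms(2,5,6) by blast
  then show ?thesis
    by (auto simp: supp_def)
qed

text \<open>A vector of smallest support among those that are nonzero at \<open>e\<close> is elementary: eliminating
  any other vector in that support would keep \<open>e\<close>.\<close>

lemma supp_covered_by_circ:
  assumes "v \<in> N" "e \<in> supp v"
  obtains C where "circ C" "e \<in> C" "C \<subseteq> supp v"
proof -
  let ?P = "\<lambda>w. w \<in> N \<and> e \<in> supp w \<and> supp w \<subseteq> supp v"
  obtain w where w: "?P w" and min: "\<And>w'. ?P w' \<Longrightarrow> card (supp w) \<le> card (supp w')"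
    using ex_has_least_nat[of ?P v "card \<circ> supp"] assms by auto
  have fin: "finite (supp w)"
    using w supp_subset finite_ground finite_subset by blast
  have no_smaller: "\<not> (w' \<in> N \<and> e \<in> supp w' \<and> supp w' \<subset> supp w)" for w'
    using min[of w'] w psubset_card_mono[OF fin, of "supp w'"] by fastforce
  have "\<not> dependent N D" if "D \<subset> supp w" for D
  proof
    assume "dependent N D"
    then obtain x where "x \<in> N" "supp x \<noteq> {}" "supp x \<subseteq> D"
      unfolding dependent_def by blast
    then obtain f where x: "x \<in> N" "supp x \<subset> supp w" "f \<in> supp x"
      using \<open>D \<subset> supp w\<close> by blast
    then have e: "e \<notin> supp x"
      using no_smaller by blast
    let ?y = "\<lambda>g. 1 * w g + (- w f / x f) * x g"
    have "f \<notin> supp ?y" "f \<in> supp w" "e \<in> supp ?y" "supp ?y \<subseteq> supp w"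
      using x e w by (auto simp: supp_def)
    then have "supp ?y \<subset> supp w"
      by blast
    then show False
      using no_smaller[of ?y] lincomb[of w x 1 "- w f / x f"] x w \<open>e \<in> supp ?y\<close> by blast
  qed
  then have "circ (supp w)"
    using w unfolding min_dependent_def dependent_def by blast
  then show ?thesis
    using that w by blast
qed

lemma dependent_contains_circ:
  assumes "dependent N X"
  obtains C where "circ C" "C \<subseteq> X"
  using assms supp_covered_by_circ unfolding dependent_def by (metis ex_in_conv order_trans)

lemma finite_signings:
  assumes "finite X"
  shows "finite (signings N X)"
proof (rule finite_subset)
  show "signings N X \<subseteq> {f. \<forall>e. (e \<in> X \<longrightarrow> f e \<in> {-1, 1}) \<and> (e \<notin> X \<longrightarrow> f e = 0)}"
    unfolding signings_def supp_def by blast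
  show "finite {f. \<forall>e. (e \<in> X \<longrightarrow> f e \<in> {-1, 1 :: real}) \<and> (e \<notin> X \<longrightarrow> f e = 0)}"
    using assms by (intro finite_set_of_finite_funs) auto
qed

lemma zero_outside: "v \<in> signings N X \<Longrightarrow> e \<notin> X \<Longrightarrow> v e = 0"
  unfolding signings_def supp_def by blast

lemma signing_values: "v \<in> signings N X \<Longrightarrow> e \<in> X \<Longrightarrow> v e \<in> {-1, 1}"
  unfolding signings_def by blast

text \<open>Nothing cancels on disjoint supports. These sums and differences will invert the passage
  to half-sums and half-differences.\<close>

lemma signings_disjoint_lincomb:
  assumes "u \<in> signings N U" "v \<in> signings N V" "U \<inter> V = {}"
  shows "(\<lambda>e. u e + v e) \<in> signings N (U \<union> V)" "(\<lambda>e. u e - v e) \<in> signings N (U \<union> V)"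
proof -
  have cases: "u e \<in> {-1, 1} \<and> v e = 0 \<or> u e = 0 \<and> v e \<in> {-1, 1}" if "e \<in> U \<union> V" for e
    using signing_values[OF assms(1)] signing_values[OF assms(2)]
      zero_outside[OF assms(1)] zero_outside[OF assms(2)] assms(3) that by blast
  have "u e = 0 \<and> v e = 0" if "e \<notin> U \<union> V" for e
    using zero_outside[OF assms(1)] zero_outside[OF assms(2)] that by blast
  with cases have *: "supp (\<lambda>e. u e + v e) = U \<union> V" "supp (\<lambda>e. u e - v e) = U \<union> V"
    "\<forall>e\<in>U \<union> V. u e + v e \<in> {-1, 1}" "\<forall>e\<in>U \<union> V. u e - v e \<in> {-1, 1}"
    unfolding supp_def by fastforce+
  have "u \<in> N" "v \<in> N"
    using assms unfolding signings_def by blast+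
  then show "(\<lambda>e. u e + v e) \<in> signings N (U \<union> V)" "(\<lambda>e. u e - v e) \<in> signings N (U \<union> V)"
    using * add diff unfolding signings_def by blast+
qed

end

text \<open>Regularity enters only through the axiom \<open>signable\<close> below.\<close>

locale regular_space = null_space +
  assumes signable: "circ C \<Longrightarrow> signings N C \<noteq> {}"
begin

text \<open>The binary cycle space, as the reduction modulo 2 of the integral null vectors.\<close>

definition cyc :: "'a set \<Rightarrow> bool" where
  "cyc U \<longleftrightarrow> (\<exists>w :: 'a \<Rightarrow> int. (\<lambda>e. of_int (w e)) \<in> N \<and> U = {e. odd (w e)})"

lemma cyc_subset_ground: "cyc U \<Longrightarrow> U \<subseteq> E"
  using supp_subset unfolding cyc_def supp_def by fastforce

lemma cyc_finite: "cyc U \<Longrightarrow> finite U"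
  using cyc_subset_ground finite_ground finite_subset by blast

lemma cyc_signing:
  assumes "v \<in> N" "\<And>e. v e \<in> {-1, 0, 1}"
  shows "cyc (supp v)"
proof -
  let ?w = "\<lambda>e. if v e = 1 then 1 else if v e = -1 then -1 else 0 :: int"
  have *: "v e = -1 \<or> v e = 0 \<or> v e = 1" for e
    using assms(2) by blast
  have "of_int (?w e) = v e" "odd (?w e) \<longleftrightarrow> v e \<noteq> 0" for e
    using *[of e] by auto
  then show ?thesis
    unfolding cyc_def supp_def using assms(1) by (intro exI[of _ ?w]) auto
qed

lemma signings_cyc: "v \<in> signings N X \<Longrightarrow> cyc X"
  using cyc_signing[of v] unfolding signings_def by (auto simp: supp_def)

lemma circ_cyc: "circ C \<Longrightarrow> cyc C"
  using signable signings_cyc by blast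

lemma cyc_empty: "cyc {}"
  using cyc_signing[OF zero] by (simp add: supp_def)

lemma cyc_sym_diff:
  assumes "cyc U" "cyc V"
  shows "cyc (sym_diff U V)"
proof -
  obtain x y where "(\<lambda>e. of_int (x e)) \<in> N" "U = {e. odd (x e)}"
    "(\<lambda>e. of_int (y e)) \<in> N" "V = {e. odd (y e)}"
    using assms unfolding cyc_def by blast
  then show ?thesis
    unfolding cyc_def using add[of "\<lambda>e. of_int (x e)" "\<lambda>e. of_int (y e)"]
    by (intro exI[of _ "\<lambda>e. x e + y e"]) auto
qed

lemma cyc_Diff: "cyc U \<Longrightarrow> cyc V \<Longrightarrow> V \<subseteq> U \<Longrightarrow> cyc (U - V)"
  using cyc_sym_diff[of U V] by (simp add: Diff_eq_empty_iff[THEN iffD2])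

text \<open>Induction on the real support of an integral vector. If this support exceeds the set of
  odd entries, an even nonzero entry is cleared by an even multiple of a signed circuit, which keeps
  all parities and shrinks the support.\<close>

lemma cyc_contains_circ:
  assumes "cyc U" "U \<noteq> {}"
  obtains C where "circ C" "C \<subseteq> U"
proof -
  let ?r = "\<lambda>w :: 'a \<Rightarrow> int. (\<lambda>e. of_int (w e)) :: 'a \<Rightarrow> real"
  have "\<exists>C. circ C \<and> C \<subseteq> {e. odd (w e)}" if "?r w \<in> N" "{e. odd (w e)} \<noteq> {}" for w
    using that
  proof (induction "card (supp (?r w))" arbitrary: w rule: less_induct)
    case less
    let ?O = "{e. odd (w e)}"
    have sub: "?O \<subseteq> supp (?r w)"
      by (auto simp: supp_def)
    show ?case
    proof (cases "supp (?r w) = ?O")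
      case True
      have "dependent N ?O"
        unfolding dependent_def using less.prems True by blast
      then show ?thesis
        using dependent_contains_circ by blast
    next
      case False
      then obtain e where e: "e \<in> supp (?r w)" "even (w e)"
        using sub by blast
      obtain C where C: "circ C" "e \<in> C" "C \<subseteq> supp (?r w)"
        using supp_covered_by_circ less.prems(1) e(1) by blast
      obtain c where c: "c \<in> signings N C"
        using signable C(1) by blast
      \<comment> \<open>The signing is real-valued; its integral copy is needed to speak of
        parity.\<close>
      define c' where "c' = (\<lambda>f. \<lfloor>c f\<rfloor>)"
      have "c f = -1 \<or> c f = 0 \<or> c f = 1" for f
        using c unfolding signings_def supp_def by blast
      then have c': "of_int (c' f) = c f" for f
        unfolding c'_def by (metis floor_of_int of_int_0 of_int_1 of_int_minus)
      have "c e = 1 \<or> c e = -1"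
        using c C(2) unfolding signings_def by auto
      then have sq: "c' e * c' e = 1"
        using c'[of e] by (metis (no_types) minus_mult_minus mult_1 of_int_eq_1_iff of_int_mult)
      \<comment> \<open>The multiplier \<open>w e * c' e\<close> is even because \<open>w e\<close>
        is, and \<open>c' e * c' e = 1\<close> makes \<open>x\<close> vanish at
        \<open>e\<close>.\<close>
      define x where "x = (\<lambda>f. w f - w e * c' e * c' f)"
      have "?r x = (\<lambda>f. 1 * ?r w f + (- of_int (w e * c' e)) * c f)"
        using c' by (auto simp: x_def)
      then have xN: "?r x \<in> N"
        using lincomb[OF less.prems(1), of c 1 "- of_int (w e * c' e)"] c
        unfolding signings_def by simp
      have odd: "{f. odd (x f)} = ?O"
        using e(2) by (auto simp: x_def)
      have "x e = 0"
        using sq by (simp add: x_def mult.assoc)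
      moreover have "x f = 0" if "w f = 0" for f
      proof -
        have "c f = 0"
          using C(3) c that unfolding signings_def supp_def by force
        then show ?thesis
          using c'[of f] that by (simp add: x_def)
      qed
      ultimately have "supp (?r x) \<subset> supp (?r w)"
        using e(1) by (auto simp: supp_def)
      then have "card (supp (?r x)) < card (supp (?r w))"
        using supp_subset[OF less.prems(1)] finite_ground finite_subset psubset_card_mono by blast
      then show ?thesis
        using less.hyps[OF _ xN] odd less.prems(2) by simp
    qed
  qed
  then show ?thesis
    using that assms unfolding cyc_def by blast
qed

section \<open>Signings of a circuit\<close>

lemma signings_empty: "signings N {} = {\<lambda>e. 0}"
  using zero by (auto simp: signings_def supp_def)

lemma circ_signing_normalized:
  assumes "circ C" "e \<in> C"
  obtains c where "c \<in> signings N C" "c e = 1"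
proof -
  obtain c where c: "c \<in> signings N C"
    using signable assms(1) by blast
  have "(\<lambda>f. (-1) * c f) \<in> signings N C"
    using c scale[of c "-1"] unfolding signings_def supp_def by auto
  moreover have "c e = 1 \<or> c e = -1"
    using c assms(2) unfolding signings_def by auto
  ultimately show ?thesis
    using that c by force
qed

lemma signings_circ_normalized_unique:
  assumes "circ C" "e \<in> C" "c \<in> signings N C" "d \<in> signings N C" "c e = d e"
  shows "c = d"
  using assms circ_vector_unique[of C e c d] unfolding signings_def by auto

text \<open>Null vectors on a circuit form a line, so a signing is determined by its value 1 or -1
  at one element.\<close>

lemma card_signings_circ:
  assumes "circ C"
  shows "card (signings N C) = 2"
proof -
  obtain e where e: "e \<in> C"
    using circ_nonempty assms by blast
  obtain c where c: "c \<in> signings N C" "c e = 1"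
    using circ_signing_normalized assms e by blast
  let ?d = "\<lambda>f. (-1) * c f"
  have d: "?d \<in> signings N C"
    using c scale[of c "-1"] unfolding signings_def supp_def by auto
  have "x = c \<or> x = ?d" if "x \<in> signings N C" for x
  proof -
    have "x e = c e \<or> x e = ?d e"
      using that e c(2) unfolding signings_def by auto
    then show ?thesis
      using signings_circ_normalized_unique[OF assms e that] c(1) d by blast
  qed
  then have "signings N C = {c, ?d}"
    using c d by blast
  moreover have "c \<noteq> ?d"
    using c(2) by (auto dest: fun_cong[of _ _ e])
  ultimately show ?thesis
    by simp
qed

end

section \<open>Minimal pairs of circuits with a bad symmetric difference\<close>

text \<open>A counterexample with inclusion-minimal union: \<open>minimal\<close> makes
  circuit-difference available for all meeting pairs whose union is properly inside
  \<open>F\<close>.\<close>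

locale minimal_bad_pair = regular_space +
  fixes C D :: "'a set"
  assumes circ_C: "circ C" and circ_D: "circ D"
    and C_neq_D: "C \<noteq> D" and C_meets_D: "C \<inter> D \<noteq> {}"
    and bad: "\<not> circ (sym_diff C D)"
    and minimal: "circ X \<Longrightarrow> circ Y \<Longrightarrow> X \<noteq> Y \<Longrightarrow> X \<inter> Y \<noteq> {} \<Longrightarrow> X \<union> Y \<subset> C \<union> D
      \<Longrightarrow> circ (sym_diff X Y)"
begin

abbreviation "F \<equiv> C \<union> D"
abbreviation "K \<equiv> C \<inter> D"
abbreviation "G \<equiv> sym_diff C D"

text \<open>If \<open>X\<close> had an element outside \<open>U \<union> V\<close>, minimality would
  make \<open>X + U\<close>, then \<open>X + U + V\<close>, and then the sum of \<open>X\<close> and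
  \<open>X + U + V\<close> circuits (\<open>+\<close> for symmetric difference). The last is
  \<open>U \<union> V\<close>, which properly contains the circuit \<open>U\<close>.\<close>

lemma circ_meeting_two_disjoint:
  assumes "circ U" "circ V" "U \<inter> V = {}" "circ X" "X \<inter> U \<noteq> {}" "X \<inter> V \<noteq> {}" "X \<union> U \<union> V \<subset> F"
  shows "X \<subseteq> U \<union> V"
proof (rule ccontr)
  assume out: "\<not> X \<subseteq> U \<union> V"
  let ?Y = "sym_diff X U" and ?Z = "sym_diff (sym_diff X U) V"
  obtain x where x: "x \<in> X" "x \<notin> U" "x \<notin> V"
    using out by blast
  obtain u where u: "u \<in> X" "u \<in> U" "u \<notin> V"
    using assms(3,5) by blast
  obtain v where v: "v \<in> X" "v \<in> V" "v \<notin> U"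
    using assms(3,6) by blast
  have "X \<noteq> U"
    using x by blast
  moreover have "X \<union> U \<subset> F"
    using assms(7) by blast
  ultimately have Y: "circ ?Y"
    using minimal[OF assms(4,1) _ assms(5)] by blast
  have "?Y \<noteq> V"
    using x by blast
  moreover have "?Y \<inter> V \<noteq> {}"
    using v by blast
  moreover have "?Y \<union> V \<subset> F"
    using assms(7) by blast
  ultimately have Z: "circ ?Z"
    by (rule minimal[OF Y assms(2)])
  have "X \<noteq> ?Z"
    using u by blast
  moreover have "X \<inter> ?Z \<noteq> {}"
    using x by blast
  moreover have "X \<union> ?Z \<subset> F"
    using assms(7) by blast
  ultimately have "circ (sym_diff X ?Z)"
    using minimal[OF assms(4) Z] by blast
  moreover have "sym_diff X ?Z = U \<union> V"
    using assms(3) by auto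
  ultimately have "circ (U \<union> V)"
    by simp
  then have "U = U \<union> V"
    using circ_antichain[OF assms(1)] by blast
  then show False
    using v by blast
qed

section \<open>Circuits and cycles inside \<open>K\<close> and \<open>G\<close>\<close>

lemma circ_not_subset_K: "circ U \<Longrightarrow> \<not> U \<subseteq> K"
  using circ_antichain[of U C] circ_antichain[of U D] circ_C circ_D C_neq_D by blast

text \<open>Such a circuit misses the nonempty set \<open>K\<close>, so it is neither
  \<open>C\<close> nor \<open>D\<close> and by the antichain property lies inside neither.\<close>

lemma circ_in_G_meets:
  assumes "circ U" "U \<subseteq> G"
  shows "U \<inter> (C - D) \<noteq> {}" "U \<inter> (D - C) \<noteq> {}"
proof -
  have "U \<noteq> C" "U \<noteq> D"
    using assms(2) C_meets_D by auto
  then have "\<not> U \<subseteq> C" "\<not> U \<subseteq> D"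
    using circ_antichain assms(1) circ_C circ_D by blast+
  then show "U \<inter> (C - D) \<noteq> {}" "U \<inter> (D - C) \<noteq> {}"
    using assms(2) by blast+
qed

text \<open>\<open>C\<close> meets \<open>U1\<close> and \<open>U2\<close> but also contains
  \<open>K\<close>, so the three must cover \<open>F\<close>. No room is left for the elements of
  \<open>U3\<close> in \<open>D - C\<close>.\<close>

lemma no_three_disjoint_circs_in_G:
  assumes "circ U1" "circ U2" "circ U3" "U1 \<union> U2 \<union> U3 \<subseteq> G"
    and "U1 \<inter> U2 = {}" "U1 \<inter> U3 = {}" "U2 \<inter> U3 = {}"
  shows False
proof -
  have "\<not> C \<subseteq> U1 \<union> U2" "C \<union> U1 \<union> U2 \<subseteq> F" "C \<inter> U1 \<noteq> {}" "C \<inter> U2 \<noteq> {}"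
    using C_meets_D assms(4) circ_in_G_meets(1)[of U1] circ_in_G_meets(1)[of U2] assms(1,2) by blast+
  then have "C \<union> U1 \<union> U2 = F"
    using circ_meeting_two_disjoint[OF assms(1,2,5) circ_C] by blast
  then show False
    using circ_in_G_meets(2)[of U3] assms(3,4,6,7) by blast
qed

lemma cyc_G: "cyc G"
  by (rule cyc_sym_diff[OF circ_cyc[OF circ_C] circ_cyc[OF circ_D]])

text \<open>A cycle that is not a circuit contains two disjoint circuits; the nonempty cycle
  \<open>G - U\<close> would supply a third.\<close>

lemma cyc_in_G_is_circ:
  assumes "cyc U" "U \<subseteq> G" "U \<noteq> {}" "U \<noteq> G"
  shows "circ U"
proof (rule ccontr)
  assume not: "\<not> circ U"
  obtain U1 where U1: "circ U1" "U1 \<subseteq> U"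
    using cyc_contains_circ assms(1,3) by blast
  have "U - U1 \<noteq> {}"
    using not U1 by (metis Diff_eq_empty_iff subset_antisym)
  then obtain U2 where U2: "circ U2" "U2 \<subseteq> U - U1"
    using cyc_contains_circ[OF cyc_Diff[OF assms(1) circ_cyc[OF U1(1)] U1(2)]] by blast
  have "G - U \<noteq> {}"
    using assms(2,4) by blast
  then obtain U3 where U3: "circ U3" "U3 \<subseteq> G - U"
    using cyc_contains_circ[OF cyc_Diff[OF cyc_G assms(1,2)]] by blast
  show False
    by (rule no_three_disjoint_circs_in_G[OF U1(1) U2(1) U3(1)]) (use U1(2) U2(2) U3(2) assms(2) in blast)+
qed

lemma circ_G_minus:
  assumes "circ U" "U \<subseteq> G"
  shows "circ (G - U)"
proof -
  have "U \<noteq> G"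
    using assms(1) bad by blast
  moreover have "U \<noteq> {}"
    using circ_nonempty assms(1) by blast
  ultimately have "G - U \<noteq> {}" "G - U \<noteq> G" "G - U \<subseteq> G"
    using assms(2) by blast+
  then show ?thesis
    using cyc_in_G_is_circ[OF cyc_Diff[OF cyc_G circ_cyc[OF assms(1)] assms(2)]] by blast
qed

lemma splitting:
  obtains Z where "circ Z" "Z \<subseteq> G" "circ (G - Z)"
proof -
  have "G \<noteq> {}"
    using C_neq_D by blast
  then obtain Z where "circ Z" "Z \<subseteq> G"
    using cyc_contains_circ[OF cyc_G] by blast
  then show ?thesis
    using that circ_G_minus by blast
qed

text \<open>A circuit splitting \<open>K\<close> cannot meet both \<open>Z\<close> and \<open>W\<close>. If it misses \<open>W\<close>, then its symmetric
  differences with \<open>C\<close> and with \<open>D\<close> split \<open>K\<close> and meet \<open>W\<close>, so they miss \<open>Z\<close>.\<close>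

lemma circ_splitting_K_aux:
  assumes Z: "circ Z" and W: "circ W" and ZW: "Z \<inter> W = {}" "Z \<union> W = G"
    and Y: "circ Y" "Y \<subseteq> F" "Y \<inter> W = {}" and k: "k1 \<in> K \<inter> Y" "k2 \<in> K - Y"
  shows False
proof -
  \<comment> \<open>Such an \<open>X\<close> leaves \<open>Z \<union> W\<close> at one of
    \<open>k1\<close>, \<open>k2\<close>, while the other keeps
    \<open>X \<union> Z \<union> W\<close> a proper subset of \<open>F\<close>.\<close>
  have not_both: "X \<inter> Z = {} \<or> X \<inter> W = {}"
    if "circ X" "X \<subseteq> F" "k1 \<in> X \<or> k2 \<in> X" "k1 \<notin> X \<or> k2 \<notin> X" for X
    using circ_meeting_two_disjoint[OF Z W ZW(1) that(1)] that k ZW(2) by blast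
  have W': "W \<inter> (C - D) \<noteq> {}" "W \<inter> (D - C) \<noteq> {}"
    using circ_in_G_meets[OF W] ZW(2) by blast+
  \<comment> \<open>\<open>C \<union> Y\<close> is a proper subset of \<open>F\<close> since
    \<open>W\<close> has an element in \<open>D - C\<close>, and \<open>Y\<close> misses
    \<open>W\<close>.\<close>
  have "circ (sym_diff C Y)"
    using k W' Y(2,3) by (intro minimal circ_C Y(1)) blast+
  then have "sym_diff C Y \<inter> Z = {}"
    using not_both[of "sym_diff C Y"] k W' Y(2,3) by blast
  moreover have "circ (sym_diff D Y)"
    using k W' Y(2,3) by (intro minimal circ_D Y(1)) blast+
  then have "sym_diff D Y \<inter> Z = {}"
    using not_both[of "sym_diff D Y"] k W' Y(2,3) by blast
  \<comment> \<open>On \<open>Z\<close> the set \<open>Y\<close> agrees with both \<open>C\<close>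
    and \<open>D\<close>, which differ at every element of \<open>G\<close>.\<close>
  ultimately have "Y \<inter> Z = {}"
    using ZW by blast
  then have "Y \<subseteq> K"
    using Y(2,3) ZW(2) by blast
  then show False
    using circ_not_subset_K Y(1) by blast
qed

text \<open>The two halves of a splitting of \<open>G\<close> are interchangeable, so
  \<open>circ_splitting_K_aux\<close> rules out missing either of them.\<close>

lemma circ_K_cases:
  assumes "circ Y" "Y \<subseteq> F"
  shows "K \<subseteq> Y \<or> K \<inter> Y = {}"
proof (rule ccontr)
  assume "\<not> ?thesis"
  then obtain k1 k2 where k: "k1 \<in> K \<inter> Y" "k2 \<in> K - Y"
    by blast
  obtain Z where Z: "circ Z" "Z \<subseteq> G" "circ (G - Z)"
    using splitting by blast
  have "\<not> Y \<subseteq> Z \<union> (G - Z)" "Y \<union> Z \<union> (G - Z) \<subset> F"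
    using k assms(2) Z(2) by blast+
  then have "Y \<inter> Z = {} \<or> Y \<inter> (G - Z) = {}"
    using circ_meeting_two_disjoint[OF Z(1,3) _ assms(1)] by blast
  then show False
  proof
    assume "Y \<inter> Z = {}"
    show False
      by (rule circ_splitting_K_aux[OF Z(3,1) _ _ assms \<open>Y \<inter> Z = {}\<close> k]) (use Z(2) in blast)+
  next
    assume "Y \<inter> (G - Z) = {}"
    show False
      by (rule circ_splitting_K_aux[OF Z(1,3) _ _ assms \<open>Y \<inter> (G - Z) = {}\<close> k]) (use Z(2) in blast)+
  qed
qed

text \<open>A circuit through \<open>k'\<close> inside the support would split \<open>K\<close>.
  Consequently null vectors supported in \<open>F\<close> are determined on all of \<open>K\<close>
  by their value at one element.\<close>

lemma vector_vanishing_on_K: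
  assumes "v \<in> N" "supp v \<subseteq> F" "k \<in> K" "v k = 0" "k' \<in> K"
  shows "v k' = 0"
proof (rule ccontr)
  assume "v k' \<noteq> 0"
  then obtain Y where "circ Y" "k' \<in> Y" "Y \<subseteq> supp v"
    using supp_covered_by_circ[OF assms(1), of k'] by (auto simp: supp_def)
  then show False
    using circ_K_cases[of Y] assms(2-5) by (auto simp: supp_def)
qed

text \<open>Otherwise \<open>X\<close> contains a circuit \<open>U\<close> of \<open>G\<close> and a disjoint circuit \<open>X0\<close> through \<open>K\<close>. With \<open>V\<close>
  the complement of \<open>U\<close> in \<open>G\<close>, the set \<open>X1\<close>, the symmetric difference of \<open>X0\<close> and \<open>V\<close>, is a circuit
  of the same kind, and comparing \<open>C\<close> with \<open>X0\<close>, \<open>U\<close> and with \<open>X1\<close>, \<open>U\<close> leaves no room for the trace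
  of \<open>C\<close> on \<open>V\<close>.\<close>

lemma cyc_through_K_is_circ:
  assumes X: "cyc X" "K \<subseteq> X" "X \<subseteq> F"
  shows "circ X"
proof (rule ccontr)
  assume not: "\<not> circ X"
  have "X \<noteq> {}"
    using X(2) C_meets_D by blast
  then obtain X1 where X1: "circ X1" "X1 \<subseteq> X"
    using cyc_contains_circ X(1) by blast
  then have "X - X1 \<noteq> {}"
    using not by (metis Diff_eq_empty_iff subset_antisym)
  then obtain X2 where X2: "circ X2" "X2 \<subseteq> X - X1"
    using cyc_contains_circ[OF cyc_Diff[OF X(1) circ_cyc[OF X1(1)] X1(2)]] by blast
  \<comment> \<open>Disjoint circuits cannot both contain the nonempty set \<open>K\<close>.\<close>
  have "K \<inter> X1 = {} \<or> K \<inter> X2 = {}"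
    using circ_K_cases[OF X1(1)] circ_K_cases[OF X2(1)] X1(2) X2(2) X(3) by blast
  then obtain U where U: "circ U" "U \<subseteq> X" "K \<inter> U = {}"
    using X1 X2 by blast
  have UG: "U \<subseteq> G"
    using U(2,3) X(3) by blast
  define V where "V = G - U"
  have V: "circ V"
    unfolding V_def by (rule circ_G_minus[OF U(1) UG])
  have "X - U \<noteq> {}"
    using U(3) X(2) C_meets_D by blast
  then obtain X0 where X0: "circ X0" "X0 \<subseteq> X - U"
    using cyc_contains_circ[OF cyc_Diff[OF X(1) circ_cyc[OF U(1)] U(2)]] by blast
  have K0: "K \<subseteq> X0"
  proof (rule ccontr)
    assume "\<not> K \<subseteq> X0"
    then have "X0 \<subseteq> V"
      using circ_K_cases[OF X0(1)] X0(2) X(3) unfolding V_def by blast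
    then have "X0 = V"
      using circ_antichain X0(1) V by blast
    \<comment> \<open>\<open>X\<close> now contains \<open>K\<close>, \<open>U\<close> and
      \<open>V\<close>. Removing the cycle \<open>G\<close> would make \<open>K\<close> a nonempty
      cycle, but \<open>K\<close> contains no circuit.\<close>
    then have "X = F"
      using X0(2) X(2,3) U(2) unfolding V_def by blast
    moreover have "G \<subseteq> F" "F - G = K"
      by blast+
    ultimately have "cyc K"
      using cyc_Diff[OF X(1) cyc_G] by simp
    then show False
      using cyc_contains_circ[OF _ C_meets_D] circ_not_subset_K by blast
  qed
  define X1 where "X1 = sym_diff X0 V"
  have VK: "V \<inter> K = {}" "V \<inter> U = {}" "V \<subseteq> F" "V \<subseteq> G" "F = K \<union> V \<union> U"
    using UG unfolding V_def by blast+
  have q2: "X0 \<subseteq> K \<union> V"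
    using X0(2) X(3) VK(5) by blast
  then have q1: "X0 \<inter> V \<noteq> {}"
    using circ_not_subset_K[OF X0(1)] by blast
  have "V \<noteq> X0"
    using K0 VK(1) C_meets_D by blast
  have C: "C \<inter> U \<noteq> {}" "C \<inter> V \<noteq> {}" "\<not> V \<subseteq> C"
    using circ_in_G_meets[OF U(1) UG] circ_in_G_meets[OF V VK(4)] by blast+
  have X1: "circ X1"
    unfolding X1_def
  proof (rule minimal[OF X0(1) V])
    show "X0 \<union> V \<subset> F"
      using q2 VK(2,5) U(3) circ_nonempty[OF U(1)] by blast
  qed (use q1 \<open>V \<noteq> X0\<close> in blast)+
  have X1_sub: "K \<subseteq> X1" "X1 \<subseteq> K \<union> V" "X1 \<inter> V = V - X0"
    using K0 q2 VK(1) unfolding X1_def by blast+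
  \<comment> \<open>\<open>C\<close> meets the disjoint circuits \<open>X'\<close> and
    \<open>U\<close>, so it lies in their union or covers with them all of \<open>F\<close>, in
    particular \<open>V - X'\<close>.\<close>
  have dichotomy: "C \<subseteq> X' \<union> U \<or> V - X' \<subseteq> C"
    if "circ X'" "K \<subseteq> X'" "X' \<subseteq> K \<union> V" for X'
  proof -
    have "U \<inter> X' = {}" "C \<inter> X' \<noteq> {}" "C \<union> X' \<union> U \<subseteq> F"
      using that(2,3) U(3) VK C_meets_D by blast+
    then have "C \<subseteq> X' \<union> U \<or> C \<union> X' \<union> U = F"
      using circ_meeting_two_disjoint[OF that(1) U(1) _ circ_C _ C(1)] by blast
    then show ?thesis
      using VK by blast
  qed
  have "\<not> X' \<subseteq> C" if "circ X'" "X' \<inter> U = {}" for X'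
    using circ_antichain[OF that(1) circ_C] C(1) that(2) by blast
  then have not_sub: "\<not> X0 \<subseteq> C" "\<not> X1 \<subseteq> C"
    using X0(1) X1 q2 X1_sub(2) VK(2) U(3) by blast+
  \<comment> \<open>\<open>X0\<close> and \<open>X1\<close> cut \<open>V\<close> into complementary
    parts. Neither part lies in \<open>C\<close>, so the dichotomies force
    \<open>C \<inter> V\<close> into both parts at once.\<close>
  have "C \<inter> V \<subseteq> X0 \<or> V - X0 \<subseteq> C"
    using dichotomy[OF X0(1) K0 q2] VK(2) by blast
  moreover have "C \<inter> V \<subseteq> V - X0 \<or> X0 \<inter> V \<subseteq> C"
    using dichotomy[OF X1 X1_sub(1,2)] VK(2) X1_sub(3) by blast
  moreover have "\<not> X0 \<inter> V \<subseteq> C" "\<not> V - X0 \<subseteq> C"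
    using not_sub q2 X1_sub(2,3) by blast+
  ultimately show False
    using C(2) by blast
qed

end

section \<open>Counting signings\<close>

text \<open>The entrywise form of both bijections below: at each element exactly one of half-sum and
  half-difference survives.\<close>

lemma signed_add_half:
  fixes a b :: real
  assumes "a \<in> {-1, 1}" "b \<in> {-1, 1}"
  shows "(a + b) / 2 \<in> {-1, 0, 1}" "(a - b) / 2 \<in> {-1, 0, 1}"
    "(a + b) / 2 = 0 \<longleftrightarrow> (a - b) / 2 \<noteq> 0"
  using assms by auto

context minimal_bad_pair
begin

section \<open>Pairs of signings of \<open>G\<close>\<close>

definition cycles_in_G :: "'a set set" where
  "cycles_in_G = {U. cyc U \<and> U \<subseteq> G}"

lemma finite_cycles_in_G: "finite cycles_in_G"
proof (rule finite_subset)
  show "cycles_in_G \<subseteq> Pow G"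
    unfolding cycles_in_G_def by blast
  show "finite (Pow G)"
    using cyc_finite[OF cyc_G] by simp
qed

lemma signings_half:
  assumes "s \<in> signings N G" "t \<in> signings N G"
  defines "U \<equiv> {e. s e + t e \<noteq> 0}"
  shows "U \<in> cycles_in_G" "(\<lambda>e. (s e + t e) / 2) \<in> signings N U"
    "(\<lambda>e. (s e - t e) / 2) \<in> signings N (G - U)"
proof -
  have st: "s \<in> N" "t \<in> N"
    using assms unfolding signings_def by blast+
  let ?p = "\<lambda>e. (s e + t e) / 2" and ?q = "\<lambda>e. (s e - t e) / 2"
  have vals: "?p e \<in> {-1, 0, 1} \<and> ?q e \<in> {-1, 0, 1} \<and> (?p e = 0 \<longleftrightarrow> ?q e \<noteq> 0)" if "e \<in> G" for e
    using signed_add_half[OF signing_values[OF assms(1) that] signing_values[OF assms(2) that]] by blast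
  have out: "?p e = 0 \<and> ?q e = 0" if "e \<notin> G" for e
    using zero_outside[OF assms(1) that] zero_outside[OF assms(2) that] by simp
  have U: "supp ?p = U"
    unfolding U_def supp_def by auto
  have UG: "U \<subseteq> G"
    using out unfolding U[symmetric] supp_def by blast
  have q: "supp ?q = G - U"
    using vals out unfolding U[symmetric] supp_def by blast
  have "\<forall>e\<in>U. ?p e \<in> {-1, 1}" "\<forall>e\<in>G - U. ?q e \<in> {-1, 1}"
    using vals UG unfolding U[symmetric] supp_def by blast+
  then show p: "?p \<in> signings N U" and "?q \<in> signings N (G - U)"
    using half_add[OF st] half_diff[OF st] U q unfolding signings_def by blast+
  show "U \<in> cycles_in_G"
    using signings_cyc[OF p] UG unfolding cycles_in_G_def by blast
qed

text \<open>Half-sum and half-difference of two signings have complementary supports in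
  \<open>G\<close>; sum and difference of these parts recover the pair.\<close>

lemma card_signings_square:
  "(card (signings N G))\<^sup>2 = (\<Sum>U\<in>cycles_in_G. card (signings N U) * card (signings N (G - U)))"
proof -
  let ?T = "signings N G"
  \<comment> \<open>The support \<open>U\<close> is recorded although the half-sum determines it, so
    that the cardinality becomes a sum over cycles.\<close>
  let ?B = "SIGMA U:cycles_in_G. signings N U \<times> signings N (G - U)"
  let ?f = "\<lambda>(s, t). ({e. s e + t e \<noteq> 0}, (\<lambda>e. (s e + t e) / 2), (\<lambda>e. (s e - t e) / 2))"
  let ?g = "\<lambda>(U, u, v). ((\<lambda>e. u e + v e), (\<lambda>e. u e - v e))"
  have g: "(\<lambda>e. u e + v e) \<in> ?T" "(\<lambda>e. u e - v e) \<in> ?T"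
    if "U \<in> cycles_in_G" "u \<in> signings N U" "v \<in> signings N (G - U)" for U u v
  proof -
    have "U \<union> (G - U) = G"
      using that(1) unfolding cycles_in_G_def by blast
    then show "(\<lambda>e. u e + v e) \<in> ?T" "(\<lambda>e. u e - v e) \<in> ?T"
      using signings_disjoint_lincomb[OF that(2,3)] by (auto simp del: Un_Diff_cancel)
  qed
  have "bij_betw ?f (?T \<times> ?T) ?B"
  proof (rule bij_betw_byWitness[where f' = ?g])
    show "\<forall>x\<in>?T \<times> ?T. ?g (?f x) = x"
      by (auto simp: add_divide_distrib[symmetric] diff_divide_distrib[symmetric])
    show "?f ` (?T \<times> ?T) \<subseteq> ?B"
      using signings_half by auto
    show "?g ` ?B \<subseteq> ?T \<times> ?T"
      using g by auto
    show "\<forall>x\<in>?B. ?f (?g x) = x"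
      by (auto simp: signings_def supp_def)
  qed
  then have "card (?T \<times> ?T) = card ?B"
    by (rule bij_betw_same_card)
  moreover have "finite (signings N U \<times> signings N (G - U))" if "U \<in> cycles_in_G" for U
  proof -
    have "finite U" "finite (G - U)"
      using that cyc_finite cyc_finite[OF cyc_G] unfolding cycles_in_G_def by blast+
    then show ?thesis
      by (intro finite_cartesian_product finite_signings)
  qed
  then have "card ?B = (\<Sum>U\<in>cycles_in_G. card (signings N U \<times> signings N (G - U)))"
    by (intro card_SigmaI finite_cycles_in_G ballI)
  ultimately show ?thesis
    unfolding card_cartesian_product power2_eq_square by simp
qed

text \<open>The cycles \<open>{}\<close> and \<open>G\<close> each contribute
  \<open>card (signings N G)\<close>; every other cycle and its complement in \<open>G\<close> are
  circuits and contribute 2 * 2. The 8 on the left accounts for the two exceptional cycles without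
  subtraction.\<close>

lemma card_signings_quadratic:
  "(card (signings N G))\<^sup>2 + 8 = 2 * card (signings N G) + 4 * card cycles_in_G"
proof -
  let ?g = "\<lambda>U. card (signings N U) * card (signings N (G - U))"
  have triv: "{{}, G} \<subseteq> cycles_in_G" "{} \<noteq> G"
    using cyc_empty cyc_G C_neq_D unfolding cycles_in_G_def by auto
  have "?g U = 4" if "U \<in> cycles_in_G - {{}, G}" for U
  proof -
    have "circ U" "circ (G - U)"
      using that cyc_in_G_is_circ circ_G_minus unfolding cycles_in_G_def by blast+
    then show ?thesis
      by (simp add: card_signings_circ)
  qed
  then have "(\<Sum>U\<in>cycles_in_G - {{}, G}. ?g U) = 4 * card (cycles_in_G - {{}, G})"
    by simp
  moreover have "card (cycles_in_G - {{}, G}) + 2 = card cycles_in_G"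
    using triv finite_cycles_in_G card_mono[OF finite_cycles_in_G triv(1)]
    by (simp add: card_Diff_subset)
  moreover have "(\<Sum>U\<in>{{}, G}. ?g U) = 2 * card (signings N G)"
    using triv(2) by (simp add: signings_empty)
  moreover have "(\<Sum>U\<in>cycles_in_G. ?g U) = (\<Sum>U\<in>cycles_in_G - {{}, G}. ?g U) + (\<Sum>U\<in>{{}, G}. ?g U)"
    by (rule sum.subset_diff[OF triv(1) finite_cycles_in_G])
  ultimately show ?thesis
    using card_signings_square by linarith
qed

section \<open>Signed cycles through \<open>K\<close>\<close>

definition cycles_through_K :: "'a set set" where
  "cycles_through_K = {X. cyc X \<and> K \<subseteq> X \<and> X \<subseteq> F}"

text \<open>Adding \<open>C\<close> is an involution that exchanges containing \<open>K\<close> with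
  missing \<open>K\<close>.\<close>

lemma card_cycles_through_K: "card cycles_through_K = card cycles_in_G"
proof (rule bij_betw_same_card)
  show "bij_betw (\<lambda>X. sym_diff X C) cycles_through_K cycles_in_G"
  proof (rule bij_betw_byWitness[where f' = "\<lambda>X. sym_diff X C"])
    show "(\<lambda>X. sym_diff X C) ` cycles_through_K \<subseteq> cycles_in_G"
      using cyc_sym_diff circ_cyc[OF circ_C]
      unfolding cycles_through_K_def cycles_in_G_def by auto
    show "(\<lambda>X. sym_diff X C) ` cycles_in_G \<subseteq> cycles_through_K"
      using cyc_sym_diff circ_cyc[OF circ_C]
      unfolding cycles_through_K_def cycles_in_G_def by auto
  qed auto
qed

text \<open>Each cycle through \<open>K\<close> is a circuit and has one signing with value 1 at
  \<open>k\<close>. So the normalized pairs on \<open>X\<close> and \<open>sym_diff X G\<close> are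
  as many as the cycles, while sum and difference identify them with
  \<open>S \<times> ?T\<close>.\<close>

lemma card_signings_dvd: "card (signings N G) dvd card cycles_in_G"
proof -
  let ?T = "signings N G"
  obtain k where k: "k \<in> K"
    using C_meets_D by blast
  obtain c where c: "c \<in> signings N C" "c k = 1"
    using circ_signing_normalized circ_C k by blast
  define R where "R X = {x \<in> signings N X. x k = 1}" for X
  \<comment> \<open>These are the possible sums \<open>x + y\<close>: both summands are 1 at
    \<open>k\<close>, and on \<open>G\<close> exactly one of them is nonzero.\<close>
  define S where "S = {s \<in> N. supp s \<subseteq> F \<and> s k = 2 \<and> (\<forall>e\<in>G. s e \<in> {-1, 1})}"
  let ?B = "SIGMA X:cycles_through_K. R X \<times> R (sym_diff X G)"
  let ?f = "\<lambda>(s, t). ({e. s e + t e \<noteq> 0}, (\<lambda>e. (s e + t e) / 2), (\<lambda>e. (s e - t e) / 2))"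
  let ?g = "\<lambda>(X, x, y). ((\<lambda>e. x e + y e), (\<lambda>e. x e - y e))"
  \<comment> \<open>The vector \<open>s - 2 * c\<close> vanishes at \<open>k\<close>, hence on
    \<open>K\<close>; the half-sums and half-differences therefore have entries 1 or -1
    there.\<close>
  have S_on_K: "s e = 2 * c e" if "s \<in> S" "e \<in> K" for s e
  proof -
    have "(\<lambda>e. 1 * s e + (-2) * c e) \<in> N"
      by (rule lincomb) (use that(1) c(1) in \<open>auto simp: S_def signings_def\<close>)
    moreover have "supp (\<lambda>e. 1 * s e + (-2) * c e) \<subseteq> F"
      using that(1) zero_outside[OF c(1)] unfolding S_def supp_def by fastforce
    ultimately show ?thesis
      using vector_vanishing_on_K[OF _ _ k _ that(2)] that(1) c(2) by (fastforce simp: S_def)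
  qed
  have f: "?f (s, t) \<in> ?B" if s: "s \<in> S" and t: "t \<in> ?T" for s t
  proof -
    let ?p = "\<lambda>e. (s e + t e) / 2" and ?q = "\<lambda>e. (s e - t e) / 2"
    define X where "X = {e. s e + t e \<noteq> 0}"
    have st: "s \<in> N" "t \<in> N"
      using s t unfolding S_def signings_def by blast+
    have onG: "?p e \<in> {-1, 0, 1} \<and> ?q e \<in> {-1, 0, 1} \<and> (?p e = 0 \<longleftrightarrow> ?q e \<noteq> 0)" if "e \<in> G" for e
      using signed_add_half[of "s e" "t e"] s signing_values[OF t that] that unfolding S_def by blast
    have onK: "?p e = c e \<and> ?q e = c e \<and> c e \<in> {-1, 1}" if "e \<in> K" for e
      using S_on_K[OF s that] zero_outside[OF t] signing_values[OF c(1)] that by auto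
    have out: "?p e = 0 \<and> ?q e = 0" if "e \<notin> F" for e
      using s zero_outside[OF t] that unfolding S_def supp_def by auto
    have "F = K \<union> G"
      by blast
    then have cases: "e \<in> G \<or> e \<in> K \<or> e \<notin> F" for e
      by blast
    have X: "supp ?p = X"
      unfolding X_def supp_def by auto
    have KX: "K \<subseteq> X"
      using onK unfolding X[symmetric] supp_def by fastforce
    have XF: "X \<subseteq> F"
      using out unfolding X[symmetric] supp_def by blast
    have "e \<in> supp ?q \<longleftrightarrow> e \<in> sym_diff X G" for e
      using cases[of e] onG[of e] onK[of e] out[of e] unfolding X[symmetric] supp_def by auto
    then have q: "supp ?q = sym_diff X G"
      by blast
    have vals: "?p e \<in> {-1, 0, 1}" "?q e \<in> {-1, 0, 1}" for e
      using cases[of e] onG[of e] onK[of e] out[of e] by auto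
    have "\<forall>e\<in>supp ?p. ?p e \<in> {-1, 1}" "\<forall>e\<in>supp ?q. ?q e \<in> {-1, 1}"
      using vals unfolding supp_def by blast+
    then have pq: "?p \<in> signings N X" "?q \<in> signings N (sym_diff X G)"
      using half_add[OF st] half_diff[OF st] X q unfolding signings_def by blast+
    then have "X \<in> cycles_through_K"
      using signings_cyc KX XF unfolding cycles_through_K_def by blast
    moreover have "?p \<in> R X" "?q \<in> R (sym_diff X G)"
      using pq onK[OF k] c(2) unfolding R_def by auto
    ultimately show ?thesis
      unfolding X_def by (simp only: case_prod_conv mem_Sigma_iff simp_thms)
  qed
  have g: "?g (X, x, y) \<in> S \<times> ?T"
    if X: "X \<in> cycles_through_K" and x: "x \<in> R X" and y: "y \<in> R (sym_diff X G)" for X x y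
  proof -
    have x': "x \<in> signings N X" "x k = 1" and y': "y \<in> signings N (sym_diff X G)" "y k = 1"
      using x y unfolding R_def by blast+
    have xy: "x \<in> N" "y \<in> N"
      using x' y' unfolding signings_def by blast+
    have onG: "x e \<in> {-1, 1} \<and> y e = 0 \<or> x e = 0 \<and> y e \<in> {-1, 1}" if "e \<in> G" for e
      using signing_values[OF x'(1)] zero_outside[OF x'(1)] signing_values[OF y'(1)]
        zero_outside[OF y'(1)] that by blast
    have out: "x e = 0 \<and> y e = 0" if "e \<notin> F" for e
      using zero_outside[OF x'(1)] zero_outside[OF y'(1)] that X unfolding cycles_through_K_def by blast
    have "supp (\<lambda>e. x e - y e) \<subseteq> F"
      using out unfolding supp_def by fastforce
    then have onK: "x e - y e = 0" if "e \<in> K" for e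
      using vector_vanishing_on_K[OF diff[OF xy] _ k _ that] x'(2) y'(2) by simp
    have G_vals: "x e + y e \<in> {-1, 1}" "x e - y e \<in> {-1, 1}" if "e \<in> G" for e
      using onG[OF that] by auto
    have "supp (\<lambda>e. x e + y e) \<subseteq> F"
      using out unfolding supp_def by fastforce
    then have "(\<lambda>e. x e + y e) \<in> S"
      using add[OF xy] x'(2) y'(2) G_vals(1) unfolding S_def by simp
    moreover have "e \<in> supp (\<lambda>e. x e - y e) \<longleftrightarrow> e \<in> G" for e
    proof (cases "e \<in> G")
      case True
      then show ?thesis
        using G_vals(2)[of e] unfolding supp_def by fastforce
    next
      case False
      then have "e \<in> K \<or> e \<notin> F"
        by blast
      then show ?thesis
        using False onK[of e] out[of e] unfolding supp_def by auto
    qed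
    then have "supp (\<lambda>e. x e - y e) = G"
      by blast
    then have "(\<lambda>e. x e - y e) \<in> ?T"
      using diff[OF xy] G_vals(2) unfolding signings_def by blast
    ultimately show ?thesis
      by simp
  qed
  have "bij_betw ?f (S \<times> ?T) ?B"
  proof (rule bij_betw_byWitness[where f' = ?g])
    show "\<forall>x\<in>S \<times> ?T. ?g (?f x) = x"
      by (auto simp: add_divide_distrib[symmetric] diff_divide_distrib[symmetric])
    show "?f ` (S \<times> ?T) \<subseteq> ?B"
    proof
      fix b
      assume "b \<in> ?f ` (S \<times> ?T)"
      then obtain s t where st: "s \<in> S" "t \<in> ?T" "b = ?f (s, t)"
        by blast
      show "b \<in> ?B"
        unfolding st(3) by (rule f[OF st(1,2)])
    qed
    show "?g ` ?B \<subseteq> S \<times> ?T"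
    proof
      fix b
      assume "b \<in> ?g ` ?B"
      then obtain X x y where Xxy: "X \<in> cycles_through_K" "x \<in> R X" "y \<in> R (sym_diff X G)"
        "b = ?g (X, x, y)"
        by (elim imageE SigmaE) simp
      show "b \<in> S \<times> ?T"
        unfolding Xxy(4) by (rule g[OF Xxy(1-3)])
    qed
    show "\<forall>x\<in>?B. ?f (?g x) = x"
      by (auto simp: R_def signings_def supp_def)
  qed
  then have card_eq: "card (S \<times> ?T) = card ?B"
    by (rule bij_betw_same_card)
  have R: "card (R X) = 1" if X: "cyc X" "K \<subseteq> X" "X \<subseteq> F" for X
  proof -
    have "circ X" "k \<in> X"
      using cyc_through_K_is_circ[OF X] X(2) k by blast+
    then obtain x where "x \<in> R X"
      using circ_signing_normalized unfolding R_def by blast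
    then have "R X = {x}"
      using signings_circ_normalized_unique[OF \<open>circ X\<close> \<open>k \<in> X\<close>] unfolding R_def by auto
    then show ?thesis
      by simp
  qed
  have RR: "card (R X \<times> R (sym_diff X G)) = 1" if "X \<in> cycles_through_K" for X
  proof -
    have "cyc (sym_diff X G)" "K \<subseteq> sym_diff X G" "sym_diff X G \<subseteq> F"
      using that cyc_sym_diff[OF _ cyc_G] unfolding cycles_through_K_def by blast+
    then show ?thesis
      using R[of X] R[of "sym_diff X G"] that unfolding cycles_through_K_def
      by (simp add: card_cartesian_product)
  qed
  have "cycles_through_K \<subseteq> Pow E"
    using cyc_subset_ground unfolding cycles_through_K_def by blast
  then have fin: "finite cycles_through_K"
    using finite_ground finite_subset by blast
  have "card ?B = (\<Sum>X\<in>cycles_through_K. card (R X \<times> R (sym_diff X G)))"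
  proof (intro card_SigmaI fin ballI)
    show "finite (R X \<times> R (sym_diff X G))" if "X \<in> cycles_through_K" for X
      using RR[OF that] by (intro card_ge_0_finite) simp
  qed
  moreover have "(\<Sum>X\<in>cycles_through_K. card (R X \<times> R (sym_diff X G))) = card cycles_in_G"
    using RR card_cycles_through_K by simp
  ultimately have "card S * card ?T = card cycles_in_G"
    using card_eq by (simp only: card_cartesian_product)
  then show ?thesis
    by (metis dvd_triv_right)
qed

text \<open>Substituting the divisibility into the quadratic relation gives \<open>n dvd 8\<close>.
  Only \<open>n = 2\<close> and \<open>n = 4\<close> solve it, both with \<open>q = 1\<close>, so
  there are two or four cycles.\<close>

lemma card_cycles_in_G: "card cycles_in_G \<le> 4"
proof -
  define n where "n = card (signings N G)"
  obtain q where q: "card cycles_in_G = n * q"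
    using card_signings_dvd unfolding n_def by blast
  have quad: "n * n + 8 = 2 * n + 4 * (n * q)"
    using card_signings_quadratic q unfolding n_def[symmetric] by (simp add: power2_eq_square)
  then have "n dvd 8"
    by (metis dvd_add_right_iff dvd_add dvd_mult dvd_triv_left dvd_triv_right)
  then have "n \<le> 8"
    by (rule dvd_imp_le) simp
  moreover have "n \<noteq> 0"
  proof
    assume "n = 0"
    with quad show False
      by simp
  qed
  ultimately have "n \<in> {1, 2, 3, 4, 5, 6, 7, 8}"
    by auto
  with quad have "n = 2 \<and> q = 1 \<or> n = 4 \<and> q = 1"
    by (elim insertE emptyE) (hypsubst, presburger)+
  then show ?thesis
    using q by auto
qed

text \<open>The cycles \<open>{}\<close>, \<open>G\<close>, \<open>Z\<close> and
  \<open>G - Z\<close> are distinct and already reach the bound 4, so no other circuit fits into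
  \<open>G\<close>.\<close>

theorem ex_skew:
  obtains Z W where "circ Z" "circ W" "Z \<inter> W = {}"
    "\<And>Y. circ Y \<Longrightarrow> Y \<subseteq> Z \<union> W \<Longrightarrow> Y = Z \<or> Y = W"
proof -
  obtain Z where Z: "circ Z" "Z \<subseteq> G" "circ (G - Z)"
    using splitting by blast
  have ne: "Z \<noteq> {}" "G - Z \<noteq> {}"
    using circ_nonempty Z by blast+
  then have "{} \<noteq> G" "{} \<noteq> Z" "{} \<noteq> G - Z" "G \<noteq> Z" "G \<noteq> G - Z" "Z \<noteq> G - Z"
    using Z(2) by blast+
  moreover have "card {P, Q, R, S} = 4"
    if "P \<noteq> Q" "P \<noteq> R" "P \<noteq> S" "Q \<noteq> R" "Q \<noteq> S" "R \<noteq> S" for P Q R S :: "'a set"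
    using that by simp
  ultimately have "card {{}, G, Z, G - Z} = 4"
    by metis
  moreover have "{{}, G, Z, G - Z} \<subseteq> cycles_in_G"
    using cyc_empty cyc_G circ_cyc Z unfolding cycles_in_G_def by blast
  ultimately have all: "cycles_in_G = {{}, G, Z, G - Z}"
    using card_cycles_in_G card_seteq[OF finite_cycles_in_G] by metis
  have "Y = Z \<or> Y = G - Z" if "circ Y" "Y \<subseteq> Z \<union> (G - Z)" for Y
  proof -
    have "Z \<union> (G - Z) = G"
      using Z(2) by blast
    then have "Y \<in> {{}, G, Z, G - Z}"
      using circ_cyc that unfolding all[symmetric] cycles_in_G_def by blast
    moreover have "Y \<noteq> {}" "Y \<noteq> G"
      using bad that(1) circ_nonempty by blast+
    ultimately show ?thesis
      by (elim insertE emptyE) metis+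
  qed
  then show ?thesis
    using that[OF Z(1,3)] by blast
qed

end

section \<open>Kernels of totally unimodular matrices\<close>

lemma dependent_mono: "dependent N X \<Longrightarrow> X \<subseteq> Y \<Longrightarrow> dependent N Y"
  unfolding dependent_def by blast

text \<open>Coefficient vectors are total functions; the support condition fixes them to 0 outside
  \<open>E\<close>.\<close>

definition column_kernel :: "nat \<Rightarrow> 'a set \<Rightarrow> (nat \<Rightarrow> 'a \<Rightarrow> real) \<Rightarrow> ('a \<Rightarrow> real) set" where
  "column_kernel m E A = {v. supp v \<subseteq> E \<and> (\<forall>i<m. (\<Sum>e\<in>E. v e * A i e) = 0)}"

lemma null_space_kernel:
  assumes "finite E"
  shows "null_space E (column_kernel m E A)"
proof
  show "finite E"
    by (rule assms)
  show "column_kernel m E A \<noteq> {}"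
    unfolding column_kernel_def supp_def by (auto intro!: exI[of _ "\<lambda>_. 0"])
  show "supp v \<subseteq> E" if "v \<in> column_kernel m E A" for v
    using that unfolding column_kernel_def by blast
  fix u v a b
  assume uv: "u \<in> column_kernel m E A" "v \<in> column_kernel m E A"
  have "(\<Sum>e\<in>E. (a * u e + b * v e) * A i e)
      = a * (\<Sum>e\<in>E. u e * A i e) + b * (\<Sum>e\<in>E. v e * A i e)" for i
    by (simp add: sum.distrib sum_distrib_left distrib_right mult.assoc)
  moreover have "supp (\<lambda>e. a * u e + b * v e) \<subseteq> supp u \<union> supp v"
    unfolding supp_def by auto
  ultimately show "(\<lambda>e. a * u e + b * v e) \<in> column_kernel m E A"
    using uv unfolding column_kernel_def by auto
qed

lemma kernel_supported:
  assumes "finite E" "supp v \<subseteq> X" "X \<subseteq> E"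
  shows "v \<in> column_kernel m E A \<longleftrightarrow> (\<forall>i<m. (\<Sum>e\<in>X. v e * A i e) = 0)"
proof -
  have "(\<Sum>e\<in>E. v e * A i e) = (\<Sum>e\<in>X. v e * A i e)" for i
    using assms by (intro sum.mono_neutral_right) (auto simp: supp_def)
  then show ?thesis
    using assms(2,3) unfolding column_kernel_def by auto
qed

lemma independent_columns_iff:
  assumes "finite E" "X \<subseteq> E"
  shows "independent_columns m A X \<longleftrightarrow> \<not> dependent (column_kernel m E A) X"
proof
  assume indep: "independent_columns m A X"
  show "\<not> dependent (column_kernel m E A) X"
  proof
    assume "dependent (column_kernel m E A) X"
    then obtain v where v: "v \<in> column_kernel m E A" "supp v \<noteq> {}" "supp v \<subseteq> X"
      unfolding dependent_def by blast
    then have "\<forall>e\<in>X. v e = 0"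
      using indep kernel_supported[OF assms(1) v(3) assms(2), of m A] unfolding independent_columns_def by blast
    then show False
      using v(2,3) unfolding supp_def by blast
  qed
next
  assume not_dep: "\<not> dependent (column_kernel m E A) X"
  show "independent_columns m A X"
    unfolding independent_columns_def
  proof (intro allI impI)
    fix a
    assume a: "\<forall>i<m. (\<Sum>e\<in>X. a e * A i e) = 0"
    \<comment> \<open>The coefficients \<open>a\<close> are arbitrary outside \<open>X\<close> and
      must be cut off to give a kernel vector.\<close>
    define v where "v e = (if e \<in> X then a e else 0)" for e
    have v: "supp v \<subseteq> X"
      unfolding supp_def v_def by auto
    have "(\<Sum>e\<in>X. v e * A i e) = (\<Sum>e\<in>X. a e * A i e)" for i
      by (rule sum.cong) (auto simp: v_def)
    then have "v \<in> column_kernel m E A"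
      using a kernel_supported[OF assms(1) v assms(2)] by simp
    then have "supp v = {}"
      using not_dep v unfolding dependent_def by blast
    then have "v e = 0" for e
      unfolding supp_def by blast
    then show "\<forall>e\<in>X. a e = 0"
      unfolding v_def by metis
  qed
qed

section \<open>Bordered minors\<close>

definition submatrix :: "(nat \<Rightarrow> 'a \<Rightarrow> real) \<Rightarrow> (nat \<Rightarrow> nat) \<Rightarrow> (nat \<Rightarrow> 'a) \<Rightarrow> nat \<Rightarrow> real mat" where
  "submatrix A r c k = mat k k (\<lambda>(i, j). A (r i) (c j))"

text \<open>The increasing enumeration of the naturals other than \<open>j\<close>; composing with
  it deletes column \<open>j\<close>.\<close>

definition skip :: "nat \<Rightarrow> nat \<Rightarrow> nat" where
  "skip j i = (if i < j then i else Suc i)"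

text \<open>The cofactors of the last row of a bordered matrix do not depend on that row.\<close>

definition border_cofactor :: "(nat \<Rightarrow> 'a \<Rightarrow> real) \<Rightarrow> (nat \<Rightarrow> nat) \<Rightarrow> (nat \<Rightarrow> 'a) \<Rightarrow> nat \<Rightarrow> nat \<Rightarrow> real" where
  "border_cofactor A r c k j = (-1) ^ (k + j) * det (submatrix A r (c \<circ> skip j) k)"

text \<open>Laplace expansion along the last row. Letting \<open>i\<close> vary, these determinants
  are the products of the rows of \<open>A\<close> with one fixed vector.\<close>

lemma det_bordered:
  "det (submatrix A (r(k := i)) c (Suc k)) = (\<Sum>j<Suc k. border_cofactor A r c k j * A i (c j))"
proof -
  let ?M = "submatrix A (r(k := i)) c (Suc k)"
  have "cofactor ?M k j = border_cofactor A r c k j" if "j < Suc k" for j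
  proof -
    have "mat_delete ?M k j = submatrix A r (c \<circ> skip j) k"
      using that by (intro eq_matI) (auto simp: mat_delete_def submatrix_def skip_def)
    then show ?thesis
      by (simp add: cofactor_def border_cofactor_def)
  qed
  moreover have "?M $$ (k, j) = A i (c j)" if "j < Suc k" for j
    using that by (simp add: submatrix_def)
  moreover have "det ?M = (\<Sum>j<Suc k. ?M $$ (k, j) * cofactor ?M k j)"
    by (rule laplace_expansion_row) (simp_all add: submatrix_def)
  ultimately show ?thesis
    by (simp add: mult.commute)
qed

lemma border_cofactor_last: "border_cofactor A r c k k = det (submatrix A r c k)"
proof -
  have "submatrix A r (c \<circ> skip k) k = submatrix A r c k"
    by (intro eq_matI) (auto simp: submatrix_def skip_def)
  moreover have "(-1 :: real) ^ (k + k) = 1"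
    by simp
  ultimately show ?thesis
    unfolding border_cofactor_def by simp
qed

text \<open>Two equal rows would make the determinant vanish. This supplies the injectivity that
  total unimodularity asks of a row selection found by bordering.\<close>

lemma det_submatrix_nonzero_imp_inj:
  assumes "det (submatrix A r c k) \<noteq> 0"
  shows "inj_on r {..<k}"
proof (rule ccontr)
  assume "\<not> inj_on r {..<k}"
  then obtain i j where ij: "i < k" "j < k" "i \<noteq> j" "r i = r j"
    unfolding inj_on_def by blast
  have "row (submatrix A r c k) i = row (submatrix A r c k) j"
    using ij by (intro eq_vecI) (auto simp: submatrix_def)
  then have "det (submatrix A r c k) = 0"
    using ij by (intro det_identical_rows[of _ k i j]) (auto simp: submatrix_def)
  with assms show False
    by simp
qed

text \<open>The vector of Cramer's rule: the fixed cofactors, carried over from column positions to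
  column labels.\<close>

definition border_vector :: "(nat \<Rightarrow> 'a \<Rightarrow> real) \<Rightarrow> (nat \<Rightarrow> nat) \<Rightarrow> (nat \<Rightarrow> 'a) \<Rightarrow> nat \<Rightarrow> 'a \<Rightarrow> real" where
  "border_vector A r c k e =
     (if e \<in> c ` {..<Suc k} then border_cofactor A r c k (the_inv_into {..<Suc k} c e) else 0)"

lemma border_vector_apply:
  "inj_on c {..<Suc k} \<Longrightarrow> j < Suc k \<Longrightarrow> border_vector A r c k (c j) = border_cofactor A r c k j"
  unfolding border_vector_def by (auto simp: the_inv_into_f_f)

lemma border_vector_last:
  "inj_on c {..<Suc k} \<Longrightarrow> border_vector A r c k (c k) = det (submatrix A r c k)"
  by (subst border_vector_apply) (simp_all only: lessI border_cofactor_last)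

lemma border_vector_supp: "supp (border_vector A r c k) \<subseteq> c ` {..<Suc k}"
  unfolding supp_def border_vector_def by auto

lemma border_vector_in_kernel:
  assumes "finite E" and c: "inj_on c {..<Suc k}" "c ` {..<Suc k} \<subseteq> E"
    and "\<And>i. i < m \<Longrightarrow> det (submatrix A (r(k := i)) c (Suc k)) = 0"
  shows "border_vector A r c k \<in> column_kernel m E A"
proof -
  have "(\<Sum>e\<in>c ` {..<Suc k}. border_vector A r c k e * A i e) = 0" if "i < m" for i
    using assms(4)[OF that] c(1)
    by (simp only: det_bordered sum.reindex comp_def) (simp add: border_vector_apply)
  then show ?thesis
    using kernel_supported[OF assms(1) border_vector_supp c(2)] by blast
qed

text \<open>Induction on the number of columns. If bordering a nonzero minor by each row gave 0, the
  border vector would be a dependency, and it is nonzero because its last entry is that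
  minor.\<close>

lemma independent_imp_nonzero_minor:
  assumes "finite E" "inj_on c {..<k}" "c ` {..<k} \<subseteq> E" "\<not> dependent (column_kernel m E A) (c ` {..<k})"
  shows "\<exists>r. r ` {..<k} \<subseteq> {..<m} \<and> det (submatrix A r c k) \<noteq> 0"
  using assms(2-4)
proof (induction k)
  case 0
  have "det (submatrix A r c 0) = 1" for r
    by (rule det_dim_zero) (simp add: submatrix_def)
  then show ?case
    by simp
next
  case (Suc k)
  have sub: "{..<k} \<subseteq> {..<Suc k}"
    by auto
  have "\<not> dependent (column_kernel m E A) (c ` {..<k})"
    using Suc.prems(3) dependent_mono image_mono[OF sub] by metis
  then obtain r where r: "r ` {..<k} \<subseteq> {..<m}" "det (submatrix A r c k) \<noteq> 0"
    using Suc.IH[OF inj_on_subset[OF Suc.prems(1) sub] order_trans[OF image_mono[OF sub] Suc.prems(2)]]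
    by blast
  have "border_vector A r c k (c k) \<noteq> 0"
    using r(2) unfolding border_vector_last[OF Suc.prems(1)] .
  then have "supp (border_vector A r c k) \<noteq> {}"
    unfolding supp_def by blast
  then have "border_vector A r c k \<notin> column_kernel m E A"
    using Suc.prems(3) border_vector_supp[of A r c k] unfolding dependent_def by blast
  then obtain i where i: "i < m" "det (submatrix A (r(k := i)) c (Suc k)) \<noteq> 0"
    using border_vector_in_kernel[OF assms(1) Suc.prems(1,2)] by blast
  have "(r(k := i)) ` {..<Suc k} \<subseteq> {..<m}"
    using r(1) i(1) by (fastforce simp: less_Suc_eq)
  then show ?case
    using i(2) by blast
qed

lemma dependent_imp_det_zero:
  assumes "finite E" "inj_on c {..<k}" "c ` {..<k} \<subseteq> E" "dependent (column_kernel m E A) (c ` {..<k})"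
    "r ` {..<k} \<subseteq> {..<m}"
  shows "det (submatrix A r c k) = 0"
proof -
  let ?M = "submatrix A r c k"
  obtain v where v: "v \<in> column_kernel m E A" "supp v \<noteq> {}" "supp v \<subseteq> c ` {..<k}"
    using assms(4) unfolding dependent_def by blast
  let ?v = "vec k (\<lambda>j. v (c j))"
  have carrier: "?M \<in> carrier_mat k k"
    by (simp add: submatrix_def)
  obtain j where "j < k" "v (c j) \<noteq> 0"
    using v(2,3) unfolding supp_def by auto
  then have "?v \<noteq> 0\<^sub>v k"
    by (metis index_vec index_zero_vec(1))
  moreover have "?M *\<^sub>v ?v = 0\<^sub>v k"
  proof (rule eq_vecI)
    fix i
    assume i: "i < dim_vec (0\<^sub>v k :: real vec)"
    then have "r i < m"
      using assms(5) by auto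
    have "(?M *\<^sub>v ?v) $ i = (\<Sum>j<k. A (r i) (c j) * v (c j))"
      using i by (simp add: submatrix_def scalar_prod_def atLeast0LessThan)
    also have "\<dots> = (\<Sum>e\<in>c ` {..<k}. v e * A (r i) e)"
      using assms(2) by (simp add: sum.reindex mult.commute)
    also have "\<dots> = 0"
      using kernel_supported[OF assms(1) v(3) assms(3)] v(1) \<open>r i < m\<close> by blast
    finally show "(?M *\<^sub>v ?v) $ i = 0\<^sub>v k $ i"
      using i by simp
  qed (simp add: submatrix_def)
  ultimately show ?thesis
    using det_0_iff_vec_prod_zero_field[OF carrier] vec_carrier by blast
qed

text \<open>Cramer's rule: the coefficients of the dependency of a circuit are minors.\<close>

lemma regular_space_kernel:
  assumes "finite E" "totally_unimodular m E A"
  shows "regular_space E (column_kernel m E A)"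
proof -
  interpret null_space E "column_kernel m E A"
    by (rule null_space_kernel[OF assms(1)])
  show ?thesis
  proof
    fix C
    assume C: "circ C"
    have "finite C" "C \<noteq> {}"
      using circ_subset_ground[OF C] assms(1) finite_subset circ_nonempty[OF C] by blast+
    then obtain k where k: "card C = Suc k"
      by (metis card_eq_0_iff not0_implies_Suc)
    obtain c where "bij_betw c {..<Suc k} C"
      using ex_bij_betw_nat_finite[OF \<open>finite C\<close>] k by (auto simp: atLeast0LessThan)
    then have c: "inj_on c {..<Suc k}" "c ` {..<Suc k} = C"
      unfolding bij_betw_def by blast+
    have cE: "c ` {..<Suc k} \<subseteq> E"
      using c(2) circ_subset_ground[OF C] by blast
    have sub: "{..<k} \<subseteq> {..<Suc k}"
      by auto
    \<comment> \<open>Without its last element the circuit is independent, which yields the nonzero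
      minor to be bordered.\<close>
    have "c ` {..<k} \<subset> C"
      using inj_on_image_mem_iff[OF c(1) _ sub, of k] c(2) by force
    then have "\<not> dependent (column_kernel m E A) (c ` {..<k})"
      using C unfolding min_dependent_def by blast
    then obtain r where r: "r ` {..<k} \<subseteq> {..<m}" "det (submatrix A r c k) \<noteq> 0"
      using independent_imp_nonzero_minor[OF assms(1) inj_on_subset[OF c(1) sub]
          order_trans[OF image_mono[OF sub] cE]] by blast
    let ?v = "border_vector A r c k"
    have dep: "dependent (column_kernel m E A) (c ` {..<Suc k})"
      using C c(2) unfolding min_dependent_def by metis
    \<comment> \<open>The row \<open>i\<close> may already occur in \<open>r\<close>; the dependent
      columns force a zero determinant in either case.\<close>
    have "det (submatrix A (r(k := i)) c (Suc k)) = 0" if "i < m" for i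
    proof (rule dependent_imp_det_zero[OF assms(1) c(1) cE dep])
      show "(r(k := i)) ` {..<Suc k} \<subseteq> {..<m}"
        using r(1) that by (fastforce simp: less_Suc_eq)
    qed
    then have v: "?v \<in> column_kernel m E A"
      by (rule border_vector_in_kernel[OF assms(1) c(1) cE])
    have "?v (c k) \<noteq> 0"
      using r(2) unfolding border_vector_last[OF c(1)] .
    then have "supp ?v \<noteq> {}"
      unfolding supp_def by blast
    then have supp_v: "supp ?v = C"
      using circ_minimal[OF C v] border_vector_supp[of A r c k] c(2) by blast
    have vals: "?v (c j) \<in> {-1, 0, 1}" if j: "j < Suc k" for j
    proof -
      have skip: "inj_on (skip j) {..<k}" "skip j ` {..<k} \<subseteq> {..<Suc k}"
        unfolding skip_def inj_on_def by auto
      have "inj_on (c \<circ> skip j) {..<k}"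
        using skip c(1) by (intro comp_inj_on) (auto intro: inj_on_subset)
      moreover have "(c \<circ> skip j) ` {..<k} \<subseteq> E"
        using skip(2) cE by (auto simp: image_comp[symmetric])
      ultimately have "det (submatrix A r (c \<circ> skip j) k) \<in> {-1, 0, 1}"
        using assms(2) det_submatrix_nonzero_imp_inj[OF r(2)] r(1)
        unfolding totally_unimodular_def submatrix_def by blast
      moreover have "(-1 :: real) ^ n * a \<in> {-1, 0, 1}" if "a \<in> {-1, 0, 1}" for n a
        using that by (cases "even n") auto
      ultimately show ?thesis
        unfolding border_vector_apply[OF c(1) j] border_cofactor_def by blast
    qed
    have "?v e \<in> {-1, 1}" if "e \<in> C" for e
    proof -
      have "e \<in> c ` {..<Suc k}"
        using that c(2) by simp
      then obtain j where "j < Suc k" "e = c j"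
        by (elim imageE) simp
      then have "?v e \<in> {-1, 0, 1}"
        using vals by metis
      moreover have "?v e \<noteq> 0"
        using that notin_supp[of e ?v] supp_v by metis
      ultimately show ?thesis
        by blast
    qed
    then show "signings (column_kernel m E A) C \<noteq> {}"
      using v supp_v unfolding signings_def by blast
  qed
qed

section \<open>Skew circuits in represented matroids\<close>

locale represented_matroid = matroid E indep + regular_space E N
  for E :: "'a set" and indep :: "'a set \<Rightarrow> bool" and N :: "('a \<Rightarrow> real) set" +
  assumes indep_iff: "X \<subseteq> E \<Longrightarrow> indep X \<longleftrightarrow> \<not> dependent N X"
begin

lemma circuit_iff_circ: "circuit C \<longleftrightarrow> circ C"
proof
  assume "circuit C"
  then show "circ C"
    unfolding circuit_def min_dependent_def
    by (meson indep_iff order_trans psubset_imp_subset)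
next
  assume "circ C"
  then show "circuit C"
    using circ_subset_ground[of C] unfolding circuit_def min_dependent_def
    by (meson indep_iff order_trans psubset_imp_subset)
qed

section \<open>Ranks of circuits and of their unions\<close>

lemma indep_if_no_circ:
  assumes "X \<subseteq> E" "\<And>C. circ C \<Longrightarrow> \<not> C \<subseteq> X"
  shows "indep X"
  using assms dependent_contains_circ indep_iff by metis

lemma circ_not_subset_indep: "circ C \<Longrightarrow> indep X \<Longrightarrow> \<not> C \<subseteq> X"
  using indep_mono circuit_iff_circ unfolding circuit_def by blast

lemma finite_circ: "circ C \<Longrightarrow> finite C"
  using circ_subset_ground finite_ground finite_subset by blast

lemma rank_attained:
  assumes "X \<subseteq> E"
  obtains Y where "Y \<subseteq> X" "indep Y" "card Y = rank X"
proof -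
  let ?S = "{Y. Y \<subseteq> X \<and> indep Y}"
  have "finite (card ` ?S)" "card ` ?S \<noteq> {}"
    using finite_subset[OF assms finite_ground] indep_empty by auto
  then have "rank X \<in> card ` ?S"
    unfolding rank_def by (rule Max_in)
  then show ?thesis
    using that by auto
qed

lemma rank_eqI:
  assumes "X \<subseteq> E" "Y \<subseteq> X" "indep Y" "card Y = n"
    and "\<And>Z. Z \<subseteq> X \<Longrightarrow> indep Z \<Longrightarrow> card Z \<le> n"
  shows "rank X = n"
  unfolding rank_def
proof (rule Max_eqI)
  show "finite (card ` {Y. Y \<subseteq> X \<and> indep Y})"
    using finite_subset[OF assms(1) finite_ground] by auto
qed (use assms in auto)

lemma rank_circ:
  assumes "circ C"
  shows "rank C = card C - 1"
proof -
  obtain e where e: "e \<in> C"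
    using circ_nonempty assms by blast
  show ?thesis
  proof (rule rank_eqI)
    show "indep (C - {e})"
      using e circuit_iff_circ assms unfolding circuit_def by blast
    show "card (C - {e}) = card C - 1"
      using e by (rule card_Diff_singleton)
    show "card Z \<le> card C - 1" if "Z \<subseteq> C" "indep Z" for Z
    proof -
      have "Z \<subset> C"
        using that circ_not_subset_indep[OF assms] by blast
      then show ?thesis
        using psubset_card_mono[OF finite_circ[OF assms] \<open>Z \<subset> C\<close>] by linarith
    qed
  qed (use circ_subset_ground[OF assms] in auto)
qed

lemma card_circ_pos: "circ C \<Longrightarrow> 0 < card C"
  using finite_circ circ_nonempty card_gt_0_iff by blast

text \<open>Deleting one element from each circuit destroys all circuits in the union, and every
  independent set misses an element of each.\<close>

lemma skew_if_only_circs: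
  assumes "circ C" "circ D" "C \<inter> D = {}"
    and only: "\<And>X. circ X \<Longrightarrow> X \<subseteq> C \<union> D \<Longrightarrow> X = C \<or> X = D"
  shows "skew_circuits C D"
proof -
  obtain c d where cd: "c \<in> C" "d \<in> D"
    using circ_nonempty assms(1,2) by blast
  have sub: "C \<union> D \<subseteq> E"
    using circ_subset_ground assms(1,2) by blast
  have fin: "finite C" "finite D"
    using finite_circ assms(1,2) by blast+
  have less: "card (Z \<inter> C) < card C" "card (Z \<inter> D) < card D" if "indep Z" for Z
    using circ_not_subset_indep[OF assms(1) that] circ_not_subset_indep[OF assms(2) that] fin
    by (auto intro!: psubset_card_mono)
  have "rank (C \<union> D) = (card C - 1) + (card D - 1)"
  proof (rule rank_eqI[OF sub])
    show "indep ((C - {c}) \<union> (D - {d}))"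
    proof (rule indep_if_no_circ)
      show "\<not> X \<subseteq> (C - {c}) \<union> (D - {d})" if "circ X" for X
        using only[OF that] cd assms(3) by blast
    qed (use sub in blast)
    show "card ((C - {c}) \<union> (D - {d})) = (card C - 1) + (card D - 1)"
      using cd fin assms(3) by (subst card_Un_disjoint) (auto simp: card_Diff_singleton)
    show "card Z \<le> (card C - 1) + (card D - 1)" if "Z \<subseteq> C \<union> D" "indep Z" for Z
    proof -
      have "Z = (Z \<inter> C) \<union> (Z \<inter> D)"
        using that(1) by blast
      then have "card Z \<le> card (Z \<inter> C) + card (Z \<inter> D)"
        by (metis card_Un_le)
      then show ?thesis
        using less[OF that(2)] by linarith
    qed
  qed auto
  then show ?thesis
    using assms sub circ_nonempty[OF assms(1)] unfolding skew_circuits_def skew_def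
    by (auto simp: circuit_iff_circ rank_circ)
qed

text \<open>A maximum independent set \<open>I\<close> of the union misses some \<open>c\<close> in
  \<open>C\<close> and \<open>d\<close> in \<open>D\<close>, and a null vector is 0 once it is
  supported in \<open>I\<close>. Eliminating at the missed elements first forces disjointness and
  then writes every null vector on the union as a combination of \<open>u\<close> and
  \<open>v\<close>.\<close>

lemma skew_circuits_structure:
  assumes "skew_circuits C D"
  shows "circ C" "circ D" "C \<inter> D = {}"
    and "circ X \<Longrightarrow> X \<subseteq> C \<union> D \<Longrightarrow> X = C \<or> X = D"
proof -
  show C: "circ C" and D: "circ D"
    using assms unfolding skew_circuits_def by (auto simp: circuit_iff_circ)
  have sub: "C \<union> D \<subseteq> E" and "C \<noteq> D"
    using assms unfolding skew_circuits_def skew_def by blast+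
  have rank: "rank (C \<union> D) = (card C - 1) + (card D - 1)"
    using assms rank_circ[OF C] rank_circ[OF D] unfolding skew_circuits_def skew_def by simp
  obtain I where I: "I \<subseteq> C \<union> D" "indep I" "card I = (card C - 1) + (card D - 1)"
    using rank_attained[OF sub] rank by metis
  have fin: "finite C" "finite D"
    using finite_circ C D by blast+
  obtain c d where cd: "c \<in> C - I" "d \<in> D - I"
    using circ_not_subset_indep[OF C I(2)] circ_not_subset_indep[OF D I(2)] by blast
  have vanish: "v = (\<lambda>e. 0)" if "v \<in> N" "supp v \<subseteq> I" for v
  proof -
    have "\<not> dependent N I"
      using I(1,2) sub indep_iff by blast
    then show ?thesis
      using that unfolding dependent_def supp_def by fastforce
  qed
  have missing: "card (C \<union> D - I) + card (C \<inter> D) = 2"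
  proof -
    have "card (C \<union> D - I) + card I = card (C \<union> D)"
      using I(1) fin by (simp add: card_Diff_subset card_mono finite_subset)
    then show ?thesis
      using card_Un_Int[OF fin] I(3) card_circ_pos[OF C] card_circ_pos[OF D] by linarith
  qed
  obtain u where u: "u \<in> N" "supp u = C"
    using circ_vector C by blast
  obtain v where v: "v \<in> N" "supp v = D"
    using circ_vector D by blast
  show disj: "C \<inter> D = {}"
  proof (rule ccontr)
    assume "C \<inter> D \<noteq> {}"
    then have "card (C \<inter> D) \<noteq> 0"
      using fin by simp
    then have "card (C \<union> D - I) \<le> 1"
      using missing by linarith
    then have one: "\<And>e. e \<in> C \<union> D - I \<Longrightarrow> e = c"
      using cd(1) fin by (metis One_nat_def UnI1 Diff_iff card_le_Suc0_iff_eq finite_Diff finite_UnI)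
    then have "c \<in> C \<inter> D"
      using cd by blast
    \<comment> \<open>If the circuits meet, \<open>c\<close> is the only missed element. The
      combination cancels there, so it is 0 and \<open>u\<close>, \<open>v\<close> are
      proportional.\<close>
    let ?w = "\<lambda>e. v c * u e + (- u c) * v e"
    have "supp ?w \<subseteq> (C \<union> D) - {c}"
      using u(2) v(2) unfolding supp_def by auto
    then have "?w = (\<lambda>e. 0)"
      using vanish[OF lincomb[OF u(1) v(1)]] one by blast
    then have "v c * u e = u c * v e" for e
      by (metis add.inverse_unique minus_mult_left minus_equation_iff)
    moreover have "u c \<noteq> 0" "v c \<noteq> 0"
      using \<open>c \<in> C \<inter> D\<close> u(2) v(2) unfolding supp_def by blast+
    ultimately have "u e = 0 \<longleftrightarrow> v e = 0" for e
      by (metis mult_eq_0_iff)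
    then show False
      using u(2) v(2) \<open>C \<noteq> D\<close> unfolding supp_def by blast
  qed
  assume X: "circ X" "X \<subseteq> C \<union> D"
  obtain x where x: "x \<in> N" "supp x = X"
    using circ_vector X(1) by blast
  have "c \<noteq> d"
    using cd disj by blast
  then have "card {c, d} = card (C \<union> D - I)" "{c, d} \<subseteq> C \<union> D - I"
    using missing disj cd by auto
  then have two: "C \<union> D - I = {c, d}"
    using fin by (metis card_seteq finite_Diff finite_UnI order_refl)
  have nz: "u c \<noteq> 0" "u d = 0" "v d \<noteq> 0" "v c = 0"
    using cd disj u(2) v(2) unfolding supp_def by blast+
  \<comment> \<open>As \<open>u d = 0\<close> and \<open>v c = 0\<close>, these coefficients make
    the remainder \<open>?y\<close> vanish at both missed elements.\<close>
  let ?a = "x c / u c" and ?b = "x d / v d"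
  let ?y = "\<lambda>e. 1 * x e + (-1) * (?a * u e + ?b * v e)"
  have "?y \<in> N"
    by (rule lincomb[OF x(1) lincomb[OF u(1) v(1)]])
  moreover have "supp ?y \<subseteq> (C \<union> D) - {c, d}"
    using X(2) x(2) u(2) v(2) nz unfolding supp_def by auto
  ultimately have y0: "?y = (\<lambda>e. 0)"
    using vanish two by blast
  have "p = q" if "1 * p + (-1) * q = 0" for p q :: real
    using that by simp
  then have eq: "x e = ?a * u e + ?b * v e" for e
    using fun_cong[OF y0] by blast
  have "C \<subseteq> X" if "x c \<noteq> 0"
  proof
    fix e
    assume e: "e \<in> C"
    then have "v e = 0" "u e \<noteq> 0"
      using disj u(2) v(2) unfolding supp_def by blast+
    then have "x e \<noteq> 0"
      using eq[of e] that nz(1) by simp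
    then show "e \<in> X"
      unfolding x(2)[symmetric] supp_def by simp
  qed
  moreover have "D \<subseteq> X" if "x d \<noteq> 0"
  proof
    fix e
    assume e: "e \<in> D"
    then have "u e = 0" "v e \<noteq> 0"
      using disj u(2) v(2) unfolding supp_def by blast+
    then have "x e \<noteq> 0"
      using eq[of e] that nz(3) by simp
    then show "e \<in> X"
      unfolding x(2)[symmetric] supp_def by simp
  qed
  moreover have "x c \<noteq> 0 \<or> x d \<noteq> 0"
  proof (rule ccontr)
    assume "\<not> ?thesis"
    then have "x e = 0" for e
      using eq[of e] by simp
    then have "supp x = {}"
      unfolding supp_def by simp
    then show False
      using circ_nonempty[OF X(1)] x(2) by simp
  qed
  ultimately have "C \<subseteq> X \<or> D \<subseteq> X"
    by blast
  then show "X = C \<or> X = D"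
    using circ_antichain C D X(1) by blast
qed

section \<open>The two implications for a represented matroid\<close>

lemma circuit_difference_imp_no_skew_circuits:
  assumes "connected_matroid" "circuit_difference"
  shows "\<not> skew_circuits C D"
proof
  assume skew: "skew_circuits C D"
  note C = skew_circuits_structure(1)[OF skew] and D = skew_circuits_structure(2)[OF skew]
    and disj = skew_circuits_structure(3)[OF skew] and only = skew_circuits_structure(4)[OF skew]
  have cdiff: "circ (sym_diff X Y)" if "circ X" "circ Y" "X \<noteq> Y" "X \<inter> Y \<noteq> {}" for X Y
    using assms(2) that unfolding circuit_difference_def circuit_iff_circ by blast
  obtain e f where ef: "e \<in> C" "f \<in> D"
    using circ_nonempty C D by blast
  moreover have "e \<in> E" "f \<in> E" "e \<noteq> f"
    using ef disj circ_subset_ground C D by blast+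
  ultimately obtain X where X: "circ X" "e \<in> X" "f \<in> X"
    using assms(1) unfolding connected_matroid_def circuit_iff_circ by blast
  \<comment> \<open>Inside the union only \<open>C\<close> and \<open>D\<close> are circuits, and
    neither contains both \<open>e\<close> and \<open>f\<close>. The element \<open>g\<close>
    survives in \<open>Y\<close> and \<open>Z\<close>, so \<open>X\<close> and \<open>Z\<close>
    meet.\<close>
  have "\<not> X \<subseteq> C \<union> D"
    using only[OF X(1)] X(2,3) ef disj by blast
  then obtain g where g: "g \<in> X" "g \<notin> C" "g \<notin> D"
    by blast
  define Y where "Y = sym_diff X C"
  define Z where "Z = sym_diff Y D"
  have Y: "circ Y"
    unfolding Y_def using X C ef g by (intro cdiff) blast+
  have "f \<in> Y" "g \<in> Y"
    unfolding Y_def using X(3) g ef disj by blast+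
  then have Z: "circ Z"
    unfolding Z_def using Y D ef g by (intro cdiff) blast+
  have "g \<in> Z" "e \<notin> Z"
    unfolding Z_def using \<open>g \<in> Y\<close> g ef disj X(2) unfolding Y_def by blast+
  then have "circ (sym_diff X Z)"
    using X(1,2) Z g by (intro cdiff) blast+
  moreover have "sym_diff X Z = C \<union> D"
    unfolding Z_def Y_def using disj by auto
  ultimately show False
    using circ_antichain[OF C, of "C \<union> D"] ef disj by auto
qed

lemma no_skew_circuits_imp_circuit_difference:
  assumes "\<not> (\<exists>C D. skew_circuits C D)"
  shows "circuit_difference"
proof (rule ccontr)
  \<comment> \<open>Pairs are packed into one argument so that a least one can be chosen by the
    cardinality of its union.\<close>
  let ?bad = "\<lambda>(C, D). circ C \<and> circ D \<and> C \<noteq> D \<and> C \<inter> D \<noteq> {} \<and> \<not> circ (sym_diff C D)"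
  assume "\<not> circuit_difference"
  then obtain P where "?bad P"
    unfolding circuit_difference_def circuit_iff_circ by blast
  then obtain Q where Q: "?bad Q"
    and min: "\<And>R. ?bad R \<Longrightarrow> card (fst Q \<union> snd Q) \<le> card (fst R \<union> snd R)"
    using ex_has_least_nat[of ?bad P "\<lambda>R. card (fst R \<union> snd R)"] by blast
  obtain C D where CD: "Q = (C, D)"
    by (cases Q)
  interpret minimal_bad_pair E N C D
  proof
    show "circ C" "circ D" "C \<noteq> D" "C \<inter> D \<noteq> {}" "\<not> circ (sym_diff C D)"
      using Q unfolding CD by auto
    fix X Y
    assume XY: "circ X" "circ Y" "X \<noteq> Y" "X \<inter> Y \<noteq> {}" "X \<union> Y \<subset> C \<union> D"
    have "finite (C \<union> D)"
      using Q finite_circ unfolding CD by simp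
    then have "card (X \<union> Y) < card (C \<union> D)"
      using XY(5) by (rule psubset_card_mono)
    then have "\<not> ?bad (X, Y)"
      using min[of "(X, Y)"] unfolding CD by auto
    then show "circ (sym_diff X Y)"
      using XY by simp
  qed
  show False
    using ex_skew skew_if_only_circs assms by metis
qed

end

theorem theorem1p1:
  fixes E :: "'a set" and indep :: "'a set \<Rightarrow> bool"
  assumes "matroid E indep"
    and "matroid.connected_matroid E indep"
    and "matroid.regular E indep"
  shows "matroid.circuit_difference E indep \<longleftrightarrow>
    \<not> (\<exists>C D. matroid.skew_circuits E indep C D)"
proof -
  interpret matroid E indep
    by (rule assms(1))
  obtain m A where A: "totally_unimodular m E A" "represented_by m A"
    using assms(3) unfolding regular_def by blast
  interpret regular_space E "column_kernel m E A"
    by (rule regular_space_kernel[OF finite_ground A(1)])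
  interpret represented_matroid E indep "column_kernel m E A"
  proof
    show "indep X \<longleftrightarrow> \<not> dependent (column_kernel m E A) X" if "X \<subseteq> E" for X
      using A(2) that independent_columns_iff[OF finite_ground that] unfolding represented_by_def by blast
  qed
  show ?thesis
    using circuit_difference_imp_no_skew_circuits[OF assms(2)] no_skew_circuits_imp_circuit_difference
    by blast
qed

end
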